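(* Let $m\ge2$. The $m$-dimensional Jacobi--Perron algorithm $T_{\rm JP}:[0,1]^m\to[0,1]^m$ defined in the context satisfies the Markov assumption and the Non-arithmeticity assumption.
   Context: Jacobi--Perron algorithm: for $(x_1,\dots,x_m)\in[0,1]^m$, $$T_{\rm JP}(x_1,\dots,x_m)=\left(\left\{\frac{x_2}{x_1}\right\},\left\{\frac{x_3}{x_1}\right\},\dots,\left\{\frac1{x_1}\right\}\right)\ \text{if }x_1\ne0,\qquad T_{\rm JP}(x)=(0,\dots,0)\ \text{otherwise},$$ where $\{\cdot\}$ is the fractional part (the entries are $\{x_k/x_1\}$ for $2\le k\le m$, followed by $\{1/x_1\}$). General setting (applied here with $I=[0,1]^m$, $T=T_{\rm JP}$ and $\{I_j\}_{j\in J}$ the partition into the domains of the branches of $T_{\rm JP}$): $I\subset\mathbb{R}^m$ is compact connected, $T:I\to I$, and $\{I_j\}_{j\in J}$ is a countable partition (modulo a null set) of $I$ into pairwise disjoint open sets with $I=\bigcup_j\overline{I_j}$, each $T|_{I_j}:I_j\to T(I_j)$ bijective and extending to a $C^{1+\mathrm{Lip}}$ map on $\overline{I_j}$. Put $h_j=(T|_{I_j})^{-1}$ and $\mathcal{H}=\{h_j:j\in J\}$. Inductively $I_{j_1,\dots,j_n}=\{x\in I_{j_1}:T(x)\in I_{j_2,\dots,j_n}\}$; then $h=h_{j_1}\circ\cdots\circ h_{j_n}$ induces a bijection $T^n(I_{j_1,\dots,j_n})\to I_{j_1,\dots,j_n}$ and is called an admissible inverse branch of depth $n$; $\mathcal{H}^n$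 is the set of these, $\mathcal{H}^\ast=\bigcup_{n\ge1}\mathcal{H}^n$, $\mathrm{Dom}(h)$ is the domain of $h$ and $|J_h(x)|=|\det Dh(x)|$. Markov assumption: $T$ is topologically transitive (some point has a dense orbit) and: (1) there is $0<\rho<1$ with $|h(x)-h(y)|\le\rho^n|x-y|$ for all $n\ge1$, $h\in\mathcal{H}^n$, $x,y\in\mathrm{Dom}(h)$; (2) there is $M>0$ with $\left|\frac{J_h(x)}{J_h(y)}-1\right|\le M|x-y|$ for all $n\ge1$, $h\in\mathcal{H}^n$, $x,y\in\mathrm{Dom}(h)$; (3) there is a finite partition (modulo a null set) $\mathcal{P}=\{P_a\}_{a\in A}$ of $I$ into pairwise disjoint open subsets with $I=\bigcup_a\overline{P_a}$ such that each $T(I_j)$ is a union of closures of elements of $\mathcal{P}$; if $I_j\cap P_a\ne\emptyset$ then $I_j\subset P_a$; and for $j\in J$, $a\in A$ either there is a unique $b\in A$ with $h_j(P_a)\subset P_b\cap I_j$, or $h_j(P_a)\cap I=\emptyset$. Non-arithmeticity assumption: there is no $c\in\mathbb{R}$ with $\{-\log|J_h(x)|:x\in I,\ h\in\mathcal{H}^\ast,\ h(x)=x\}\subset c\mathbb{Z}$.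
   Formalization: Markov (1) is proved with Cρ^n|x-y| (C=1 fails for digits (0,…,0,1)); {I_j} is the digit domains cut by the orderings of the coordinates (needed in (3) for m≥3); I is the closure of ∪I_j; in (3) the closure of T(I_j) is the union of closures. *)

theory Defs
  imports "HOL-Analysis.Analysis"
begin

section \<open>Partitioned systems and their inverse branches\<close>

text \<open>
  A partition is a set of cells, and a cell serves as its own index. All cells are open in
  \<open>real ^ 'm\<close>, so that derivatives on them make sense. The covering condition is written
  \<open>closure (\<Union>\<P>) = I\<close>: for finite \<open>\<P>\<close> this says that \<open>I\<close> is the union of the closures of the
  cells, whereas for a countable partition that union may miss a null set (for the Gauss map the
  point 0, for Jacobi--Perron the face \<open>x\<^sub>1 = 0\<close>).
\<close>

definition open_partition_mod_null :: "(real ^ 'm::finite) set \<Rightarrow> (real ^ 'm) set set \<Rightarrow> bool" where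
  "open_partition_mod_null I \<P> \<longleftrightarrow>
     (\<forall>S\<in>\<P>. open S \<and> S \<noteq> {} \<and> S \<subseteq> I) \<and>
     pairwise disjnt \<P> \<and>
     negligible (I - \<Union>\<P>) \<and>
     closure (\<Union>\<P>) = I"

definition extends_C1_Lip :: "(real ^ 'm \<Rightarrow> real ^ 'm) \<Rightarrow> (real ^ 'm::finite) set \<Rightarrow> bool" where
  "extends_C1_Lip T S \<longleftrightarrow>
     (\<exists>g (g' :: real ^ 'm \<Rightarrow> (real ^ 'm) \<Rightarrow>\<^sub>L (real ^ 'm)) L.
        (\<forall>x\<in>S. g x = T x) \<and>
        (\<forall>x\<in>closure S. (g has_derivative blinfun_apply (g' x)) (at x within closure S)) \<and>
        L-lipschitz_on (closure S) g')"

definition piecewise_system ::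
    "(real ^ 'm::finite) set \<Rightarrow> (real ^ 'm \<Rightarrow> real ^ 'm) \<Rightarrow> (real ^ 'm) set set \<Rightarrow> bool" where
  "piecewise_system I T \<I> \<longleftrightarrow>
     compact I \<and> connected I \<and> T \<in> I \<rightarrow> I \<and>
     countable \<I> \<and> open_partition_mod_null I \<I> \<and>
     (\<forall>S\<in>\<I>. inj_on T S \<and> extends_C1_Lip T S)"

text \<open>
  An inverse branch of depth \<open>n\<close> is given by the list \<open>[I\<^sub>j\<^sub>1, \<dots>, I\<^sub>j\<^sub>n]\<close> of cells. Since functions
  are total, \<open>inverse_branch T w\<close> is meaningful only on \<open>branch_dom T w\<close>.
\<close>

fun cylinder :: "('a \<Rightarrow> 'a) \<Rightarrow> 'a set list \<Rightarrow> 'a set" where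
  "cylinder T [] = UNIV"
| "cylinder T (S # w) = {x \<in> S. T x \<in> cylinder T w}"

fun inverse_branch :: "('a \<Rightarrow> 'a) \<Rightarrow> 'a set list \<Rightarrow> 'a \<Rightarrow> 'a" where
  "inverse_branch T [] = id"
| "inverse_branch T (S # w) = the_inv_into S T \<circ> inverse_branch T w"

definition branch_dom :: "('a \<Rightarrow> 'a) \<Rightarrow> 'a set list \<Rightarrow> 'a set" where
  "branch_dom T w = (T ^^ length w) ` cylinder T w"

definition admissible_words :: "('a \<Rightarrow> 'a) \<Rightarrow> 'a set set \<Rightarrow> nat \<Rightarrow> 'a set list set" where
  "admissible_words T \<I> n = {w. length w = n \<and> set w \<subseteq> \<I> \<and> cylinder T w \<noteq> {}}"

definition abs_jacobian :: "(real ^ 'm \<Rightarrow> real ^ 'm::finite) \<Rightarrow> real ^ 'm \<Rightarrow> real" where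
  "abs_jacobian h x = \<bar>det (matrix (frechet_derivative h (at x)))\<bar>"


section \<open>The Markov and non-arithmeticity assumptions\<close>

definition topologically_transitive :: "'a::topological_space set \<Rightarrow> ('a \<Rightarrow> 'a) \<Rightarrow> bool" where
  "topologically_transitive I T \<longleftrightarrow> (\<exists>x\<in>I. I \<subseteq> closure (range (\<lambda>n. (T ^^ n) x)))"

text \<open>
  The constant \<open>C\<close> is needed: already the Gauss map has an inverse branch \<open>1 / (1 + y)\<close> whose
  derivative at 0 has modulus 1. Likewise, the Jacobi--Perron inverse branch with digits
  \<open>(0, \<dots>, 0, 1)\<close>, namely \<open>h(y) = (1, y\<^sub>1, \<dots>, y\<^sub>m\<^sub>-\<^sub>1) / (1 + y\<^sub>m)\<close>, satisfies no bound
  \<open>norm (h x - h y) \<le> \<rho> * norm (x - y)\<close> with \<open>\<rho> < 1\<close> near the origin.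
\<close>

definition uniformly_contracting ::
    "(real ^ 'm::finite \<Rightarrow> real ^ 'm) \<Rightarrow> (real ^ 'm) set set \<Rightarrow> bool" where
  "uniformly_contracting T \<I> \<longleftrightarrow>
     (\<exists>\<rho> C. 0 < \<rho> \<and> \<rho> < 1 \<and> 0 < C \<and>
       (\<forall>n\<ge>1. \<forall>w\<in>admissible_words T \<I> n. \<forall>x\<in>branch_dom T w. \<forall>y\<in>branch_dom T w.
          norm (inverse_branch T w x - inverse_branch T w y) \<le> C * \<rho> ^ n * norm (x - y)))"

definition bounded_distortion ::
    "(real ^ 'm::finite \<Rightarrow> real ^ 'm) \<Rightarrow> (real ^ 'm) set set \<Rightarrow> bool" where
  "bounded_distortion T \<I> \<longleftrightarrow>
     (\<exists>M>0. \<forall>n\<ge>1. \<forall>w\<in>admissible_words T \<I> n. \<forall>x\<in>branch_dom T w. \<forall>y\<in>branch_dom T w.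
        \<bar>abs_jacobian (inverse_branch T w) x / abs_jacobian (inverse_branch T w) y - 1\<bar>
          \<le> M * norm (x - y))"

text \<open>
  The image \<open>T ` S\<close> of a cell need not be closed, so the condition that it is a union of closures of
  elements of \<open>\<P>\<close> is stated for the closure of \<open>T ` S\<close>, the image of \<open>closure S\<close> under the continuous
  extension of \<open>T\<close>. The inverse branch of \<open>S\<close> is a map on \<open>T ` S\<close>: in the first alternative of the
  last condition \<open>P\<close> must lie in this domain, in the second one the image is that of the part of \<open>P\<close>
  in the domain.
\<close>

definition finite_markov_partition ::
    "(real ^ 'm::finite) set \<Rightarrow> (real ^ 'm \<Rightarrow> real ^ 'm) \<Rightarrow> (real ^ 'm) set set
      \<Rightarrow> (real ^ 'm) set set \<Rightarrow> bool" where
  "finite_markov_partition I T \<I> \<P> \<longleftrightarrow>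
     finite \<P> \<and> open_partition_mod_null I \<P> \<and>
     (\<forall>S\<in>\<I>. \<exists>\<Q>\<subseteq>\<P>. closure (T ` S) = (\<Union>Q\<in>\<Q>. closure Q)) \<and>
     (\<forall>S\<in>\<I>. \<forall>P\<in>\<P>. S \<inter> P \<noteq> {} \<longrightarrow> S \<subseteq> P) \<and>
     (\<forall>S\<in>\<I>. \<forall>P\<in>\<P>.
        (P \<subseteq> T ` S \<and> (\<exists>!P'. P' \<in> \<P> \<and> the_inv_into S T ` P \<subseteq> P' \<inter> S)) \<or>
        the_inv_into S T ` (P \<inter> T ` S) \<inter> I = {})"

definition markov_assumption ::
    "(real ^ 'm::finite) set \<Rightarrow> (real ^ 'm \<Rightarrow> real ^ 'm) \<Rightarrow> (real ^ 'm) set set \<Rightarrow> bool" where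
  "markov_assumption I T \<I> \<longleftrightarrow>
     topologically_transitive I T \<and>
     uniformly_contracting T \<I> \<and>
     bounded_distortion T \<I> \<and>
     (\<exists>\<P>. finite_markov_partition I T \<I> \<P>)"

definition non_arithmeticity_assumption ::
    "(real ^ 'm::finite) set \<Rightarrow> (real ^ 'm \<Rightarrow> real ^ 'm) \<Rightarrow> (real ^ 'm) set set \<Rightarrow> bool" where
  "non_arithmeticity_assumption I T \<I> \<longleftrightarrow>
     \<not> (\<exists>c::real.
          {- ln (abs_jacobian (inverse_branch T w) x) | x w n.
             1 \<le> n \<and> w \<in> admissible_words T \<I> n \<and>
             x \<in> I \<inter> branch_dom T w \<and> inverse_branch T w x = x}
          \<subseteq> range (\<lambda>k::int. c * of_int k))"


section \<open>The Jacobi--Perron algorithm\<close>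

text \<open>
  The algorithm depends on the order of the coordinates, which is given by an enumeration \<open>e\<close> of the
  index type: \<open>bij_betw e {1..CARD('m)} UNIV\<close>, the coordinate \<open>x\<^sub>k\<close> being \<open>x $ e k\<close>. The vector
  \<open>jp_quot e x\<close> is \<open>(x\<^sub>2 / x\<^sub>1, \<dots>, x\<^sub>m / x\<^sub>1, 1 / x\<^sub>1)\<close>.
\<close>

definition unit_cube :: "(real ^ 'm::finite) set" where
  "unit_cube = {x. \<forall>i. 0 \<le> x $ i \<and> x $ i \<le> 1}"

definition jp_quot :: "(nat \<Rightarrow> 'm) \<Rightarrow> real ^ 'm::finite \<Rightarrow> real ^ 'm" where
  "jp_quot e x =
     (\<chi> i. if i = e CARD('m) then 1 / x $ e 1
           else x $ e (Suc (the_inv_into {1..CARD('m)} e i)) / x $ e 1)"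

definition jp_map :: "(nat \<Rightarrow> 'm) \<Rightarrow> real ^ 'm::finite \<Rightarrow> real ^ 'm" where
  "jp_map e x = (if x $ e 1 \<noteq> 0 then (\<chi> i. frac (jp_quot e x $ i)) else 0)"

text \<open>
  \<open>jp_digit_domain e a\<close> is the open set on which the algorithm has the partial quotients
  \<open>a\<close>, that is, \<open>jp_map e x = jp_quot e x - a\<close>. For \<open>m \<ge> 3\<close> these sets violate the requirement that a
  cell meeting an element of the Markov partition is contained in it: the images of the digit domains
  force that partition to separate \<open>x\<^sub>2 < x\<^sub>m\<close> from \<open>x\<^sub>2 > x\<^sub>m\<close>, and both occur in a digit domain with
  \<open>a\<^sub>1 = a\<^sub>m\<^sub>-\<^sub>1\<close>. So the branches are those obtained by cutting the digit domains along the
  finitely many orderings of the coordinates. For \<open>m = 2\<close> nothing is cut: the digit \<open>a\<^sub>1\<close> is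
  0 if \<open>x\<^sub>2 < x\<^sub>1\<close> and positive if \<open>x\<^sub>2 > x\<^sub>1\<close>.
\<close>

definition jp_digit_domain :: "(nat \<Rightarrow> 'm) \<Rightarrow> ('m \<Rightarrow> int) \<Rightarrow> (real ^ 'm::finite) set" where
  "jp_digit_domain e a =
     {x. (\<forall>i. 0 < x $ i \<and> x $ i < 1) \<and>
         (\<forall>i. of_int (a i) < jp_quot e x $ i \<and> jp_quot e x $ i < of_int (a i) + 1)}"

definition order_chamber :: "('m \<times> 'm) set \<Rightarrow> (real ^ 'm::finite) set" where
  "order_chamber r =
     {x. (\<forall>i. 0 < x $ i \<and> x $ i < 1) \<and> inj (\<lambda>i. x $ i) \<and> {(i, j). x $ i < x $ j} = r}"

definition jp_partition :: "(nat \<Rightarrow> 'm) \<Rightarrow> (real ^ 'm::finite) set set" where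
  "jp_partition e = {jp_digit_domain e a \<inter> order_chamber r | a r. True} - {{}}"

end

theory Submission
  imports Defs
begin

text \<open>
  On the set with partial quotients \<open>a\<close> the algorithm is inverted by the projective map
  \<open>y \<mapsto> (1, y\<^sub>1 + a\<^sub>1, \<dots>, y\<^sub>m\<^sub>-\<^sub>1 + a\<^sub>m\<^sub>-\<^sub>1) / (y\<^sub>m + a\<^sub>m)\<close>, and the digits that occur are those with
  \<open>0 \<le> a\<^sub>i \<le> a\<^sub>m\<close> and \<open>a\<^sub>m \<ge> 1\<close>. All parts of the theorem are read off from this formula.

  Markov partition. The order of the coordinates of the image of \<open>y\<close>, including the question
  whether they are below 1, is decided by \<open>a\<close> and by the order of the coordinates of \<open>y\<close>
  (\<open>branch_chamber_invariant\<close>). Hence the image of a cell is, up to a null set, a union of order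
  chambers, and the finitely many chambers are a Markov partition.

  Distortion and contraction. An affine form \<open>c\<^sub>0 + c\<^sub>1 y\<^sub>1 + \<dots> + c\<^sub>m y\<^sub>m\<close> composed with a branch is
  again an affine form divided by the denominator of the branch. A composition of branches is
  therefore a vector of quotients \<open>N\<^sub>i / D\<close> of affine forms, and its Jacobian has modulus
  \<open>1 / D ^ (m + 1)\<close>. The coefficients of \<open>D\<close> are successive denominators of the convergents; they grow,
  so \<open>0 \<le> c\<^sub>i \<le> c\<^sub>0\<close>, which bounds the relative variation of \<open>D\<close> over the cube. For the
  contraction, suppose \<open>\<alpha> D \<le> N \<le> \<beta> D\<close> coefficientwise. Pulling back preserves this. Since \<open>a\<^sub>m\<close> is the
  largest digit, a new constant coefficient owes at least the proportion \<open>1 / (m + 1)\<close> to the old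
  one, and after \<open>m\<close> steps every coefficient has been a constant coefficient. So \<open>m\<close> steps shrink
  \<open>\<beta> - \<alpha>\<close> by the fixed factor \<open>1 - (1 / (m + 1)) ^ m\<close> (\<open>pullback_word_contraction_block\<close>).

  Transitivity. Cylinders of large depth are small, and the image of a cylinder under the
  corresponding iterate contains a chamber. From a point \<open>x\<close> of any chamber one branch leads to the chamber of
  \<open>(x\<^sub>2, \<dots>, x\<^sub>m, t)\<close>, where \<open>t\<close> exceeds all \<open>x\<^sub>i\<close>. After \<open>m\<close> such steps the coordinates are
  increasing, and the chamber of increasing vectors contains the cell with digits \<open>a\<^sub>i = i\<close>, which
  is mapped onto the whole open cube. So the preimages of any open set under the iterates are
  dense, and the Baire category theorem provides a dense orbit.

  Non-arithmeticity. For \<open>N > m\<close> the branch with digits \<open>(1, \<dots>, m - 1, N)\<close> maps the closed cube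
  into the open one and has a fixed point there. Its contribution is \<open>(m + 1) ln t\<close> with
  \<open>N < t < N + 1\<close>. As \<open>N\<close> grows these numbers stay distinct while consecutive ones become
  arbitrarily close, so they do not lie in a lattice \<open>c \<int>\<close>.
\<close>

section \<open>The cyclic successor of a coordinate\<close>

locale jacobi_perron =
  fixes e :: "nat \<Rightarrow> 'm::finite"
  assumes card_ge_2: "CARD('m) \<ge> 2"
    and enum: "bij_betw e {1..CARD('m)} UNIV"
begin

definition first :: 'm where "first = e 1"
definition lst :: 'm where "lst = e CARD('m)"

definition pos :: "'m \<Rightarrow> nat" where
  "pos = the_inv_into {1..CARD('m)} e"

text \<open>
  The cyclic closure makes the inverse branches uniform: each coordinate of the image is the
  successor of exactly one digit position, the last position having the first coordinate as
  successor.
\<close>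

definition nxt :: "'m \<Rightarrow> 'm" where
  "nxt i = (if i = lst then first else e (Suc (pos i)))"

abbreviation "prv \<equiv> inv nxt"

lemma e_pos [simp]: "e (pos i) = i"
  unfolding pos_def using enum
  by (simp add: bij_betw_def f_the_inv_into_f)

lemma pos_e: "1 \<le> k \<Longrightarrow> k \<le> CARD('m) \<Longrightarrow> pos (e k) = k"
  unfolding pos_def using enum by (simp add: bij_betw_def the_inv_into_f_f)

lemma pos_ge_1: "1 \<le> pos i" and pos_le_card: "pos i \<le> CARD('m)"
proof -
  have "pos i \<in> {1..CARD('m)}"
    unfolding pos_def using enum by (intro the_inv_into_into) (auto simp: bij_betw_def)
  then show "1 \<le> pos i" "pos i \<le> CARD('m)" by auto
qed

lemma pos_first [simp]: "pos first = 1" and pos_lst [simp]: "pos lst = CARD('m)"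
  unfolding first_def lst_def using card_ge_2 by (auto intro!: pos_e)

lemma pos_inject: "pos i = pos j \<longleftrightarrow> i = j"
  by (metis e_pos)

lemma nxt_lst [simp]: "nxt lst = first"
  by (simp add: nxt_def)

lemma pos_nxt: "i \<noteq> lst \<Longrightarrow> pos (nxt i) = Suc (pos i)"
proof -
  assume "i \<noteq> lst"
  then have "pos i \<noteq> CARD('m)" by (metis e_pos lst_def)
  with pos_le_card[of i] \<open>i \<noteq> lst\<close> show ?thesis by (simp add: nxt_def pos_e)
qed

lemma pos_nxt_eq: "pos (nxt i) = (if i = lst then 1 else Suc (pos i))"
  using pos_nxt pos_first by auto

lemma bij_nxt: "bij nxt"
proof -
  have "inj nxt"
  proof (rule injI)
    fix i j assume "nxt i = nxt j"
    then have "pos (nxt i) = pos (nxt j)" by simp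
    then have "i = lst \<and> j = lst \<or> pos i = pos j"
      using pos_ge_1[of i] pos_ge_1[of j] unfolding pos_nxt_eq
      by (simp only: One_nat_def split: if_splits) arith+
    then show "i = j" using pos_inject by blast
  qed
  then show ?thesis by (simp add: bij_def finite_UNIV_inj_surj)
qed

lemma prv_nxt [simp]: "prv (nxt i) = i" and nxt_prv [simp]: "nxt (prv i) = i"
  using bij_nxt by (auto simp: bij_def surj_f_inv_f)

lemma nxt_inject [simp]: "nxt i = nxt j \<longleftrightarrow> i = j"
  by (metis prv_nxt)

lemma nxt_eq_first [simp]: "nxt i = first \<longleftrightarrow> i = lst"
  by (metis nxt_inject nxt_lst)

lemma all_nxt: "(\<forall>j. P j) \<longleftrightarrow> (\<forall>i. P (nxt i))"
  by (metis nxt_prv)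

lemma jp_quot_nth: "jp_quot e x $ i = (if i = lst then 1 else x $ nxt i) / x $ first"
  by (simp add: jp_quot_def nxt_def pos_def first_def lst_def)

section \<open>Inverse branches, digits and cells\<close>

text \<open>
  The numerator of the coordinate \<open>nxt i\<close> of the branch, so that the position \<open>lst\<close> stands for
  the constant numerator 1 of the first coordinate.
\<close>

definition numer :: "('m \<Rightarrow> int) \<Rightarrow> real ^ 'm \<Rightarrow> 'm \<Rightarrow> real" where
  "numer a y i = (if i = lst then 1 else y $ i + of_int (a i))"

definition denom :: "('m \<Rightarrow> int) \<Rightarrow> real ^ 'm \<Rightarrow> real" where
  "denom a y = y $ lst + of_int (a lst)"

definition branch :: "('m \<Rightarrow> int) \<Rightarrow> real ^ 'm \<Rightarrow> real ^ 'm" where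
  "branch a y = (\<chi> j. numer a y (prv j) / denom a y)"

definition admissible_digits :: "('m \<Rightarrow> int) \<Rightarrow> bool" where
  "admissible_digits a \<longleftrightarrow> 1 \<le> a lst \<and> (\<forall>i. 0 \<le> a i \<and> a i \<le> a lst)"

lemma branch_nxt [simp]: "branch a y $ nxt i = numer a y i / denom a y"
  by (simp add: branch_def)

lemma branch_first [simp]: "branch a y $ first = 1 / denom a y"
  using branch_nxt[of a y lst] by (simp add: numer_def)

lemma quot_branch:
  assumes "denom a y \<noteq> 0"
  shows "jp_quot e (branch a y) $ i = y $ i + of_int (a i)"
  using assms by (auto simp: jp_quot_nth numer_def denom_def)

lemma branch_quot:
  assumes "x $ first \<noteq> 0"
  shows "branch a (\<chi> i. jp_quot e x $ i - of_int (a i)) = x"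
proof -
  have "branch a (\<chi> i. jp_quot e x $ i - of_int (a i)) $ nxt i = x $ nxt i" for i
    using assms by (auto simp: numer_def denom_def jp_quot_nth)
  then show ?thesis by (metis vec_eq_iff nxt_prv)
qed

abbreviation open_cube :: "(real ^ 'm) set" where
  "open_cube \<equiv> {x. \<forall>i. 0 < x $ i \<and> x $ i < 1}"

abbreviation "digit_domain \<equiv> jp_digit_domain e"
abbreviation "T \<equiv> jp_map e"
abbreviation "cells \<equiv> jp_partition e"

lemma open_cube_eq_box: "open_cube = box 0 1"
  by (auto simp: mem_box_cart)

lemma unit_cube_eq_cbox: "unit_cube = (cbox 0 1 :: (real ^ 'm) set)"
  by (auto simp: mem_box_cart unit_cube_def)

lemma open_open_cube: "open open_cube"
  by (simp add: open_cube_eq_box open_box)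

lemma open_cube_subset: "open_cube \<subseteq> unit_cube"
  by (auto simp: unit_cube_def less_imp_le)

lemma closure_open_cube: "closure open_cube = unit_cube"
proof -
  have "box 0 1 \<noteq> ({} :: (real ^ 'm) set)" by (simp add: interval_ne_empty_cart)
  then show ?thesis by (simp add: open_cube_eq_box unit_cube_eq_cbox closure_box)
qed

text \<open>
  All quotients are positive, and \<open>1 / x\<^sub>1\<close> exceeds 1 and every \<open>x\<^sub>k / x\<^sub>1\<close>, because \<open>x\<close> lies in
  the open cube; taking integer parts gives the constraints on the digits.
\<close>

lemma digit_domain_admissible:
  assumes "x \<in> digit_domain a"
  shows "admissible_digits a"
proof -
  have x: "0 < x $ i" "x $ i < 1" "of_int (a i) < jp_quot e x $ i"
    "jp_quot e x $ i < of_int (a i) + 1" for i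
    using assms by (auto simp: jp_digit_domain_def)
  have q: "0 < jp_quot e x $ i" for i
    using x(1) by (simp add: jp_quot_nth)
  have q1: "1 < jp_quot e x $ lst"
    using x(1,2)[of first] by (simp add: jp_quot_nth)
  have ql: "jp_quot e x $ i \<le> jp_quot e x $ lst" for i
    using x(1)[of first] x(2)[of "nxt i"] by (auto simp: jp_quot_nth divide_right_mono)
  show ?thesis unfolding admissible_digits_def
  proof (intro conjI allI)
    have "1 < real_of_int (a lst) + 1" using q1 x(4)[of lst] by linarith
    then show "1 \<le> a lst" by linarith
    fix i
    have "0 < real_of_int (a i) + 1" using q[of i] x(4)[of i] by linarith
    then show "0 \<le> a i" by linarith
    have "real_of_int (a i) < real_of_int (a lst) + 1" using ql[of i] x(3)[of i] x(4)[of lst] by linarith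
    then show "a i \<le> a lst" by linarith
  qed
qed

lemma jp_map_digit_domain:
  assumes "x \<in> digit_domain a"
  shows "T x = (\<chi> i. jp_quot e x $ i - of_int (a i))" "T x \<in> open_cube" "branch a (T x) = x"
proof -
  have x: "0 < x $ i" "of_int (a i) < jp_quot e x $ i"
    "jp_quot e x $ i < of_int (a i) + 1" for i
    using assms by (auto simp: jp_digit_domain_def)
  have fl: "\<lfloor>jp_quot e x $ i\<rfloor> = a i" for i
    using x(2,3)[of i] by linarith
  have x1: "x $ first \<noteq> 0" using x(1)[of first] by simp
  then show 1: "T x = (\<chi> i. jp_quot e x $ i - of_int (a i))"
    unfolding jp_map_def first_def[symmetric] by (simp add: frac_def fl)
  show "T x \<in> open_cube" using x(2,3) unfolding 1 by (auto simp: algebra_simps)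
  show "branch a (T x) = x" unfolding 1 by (rule branch_quot[OF x1])
qed

lemma denom_ge_1: "admissible_digits a \<Longrightarrow> (\<And>i. 0 \<le> y $ i) \<Longrightarrow> 1 \<le> denom a y"
  unfolding denom_def admissible_digits_def by (metis add.commute add_increasing2 of_int_1_le_iff)

lemma branch_nonneg: 
  assumes "admissible_digits a" "\<And>i. 0 \<le> y $ i" shows "0 \<le> branch a y $ i"
proof -
  have "0 \<le> numer a y j / denom a y" for j
    using denom_ge_1[OF assms] assms by (auto simp: numer_def admissible_digits_def)
  then show ?thesis by (simp add: branch_def)
qed

text \<open>
  The hypothesis that the image lies in the open cube encodes the rule that a digit \<open>a\<^sub>i = a\<^sub>m\<close>
  with \<open>i < m\<close> forces \<open>y\<^sub>i < y\<^sub>m\<close>.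
\<close>

lemma branch_in_digit_domain:
  assumes "admissible_digits a" "y \<in> open_cube" "branch a y \<in> open_cube"
  shows "branch a y \<in> digit_domain a" "T (branch a y) = y"
proof -
  have "denom a y \<ge> 1" using assms by (intro denom_ge_1) (auto simp: less_imp_le)
  then have q: "jp_quot e (branch a y) $ i = y $ i + of_int (a i)" for i
    by (intro quot_branch) auto
  show 1: "branch a y \<in> digit_domain a" using assms by (auto simp: jp_digit_domain_def q)
  show "T (branch a y) = y" by (simp add: jp_map_digit_domain[OF 1] q vec_eq_iff)
qed

lemma chamber_open_cube: "x \<in> order_chamber r \<Longrightarrow> x \<in> open_cube"
  by (auto simp: order_chamber_def)

lemma image_cell:
  assumes "admissible_digits a"
  shows "T ` (digit_domain a \<inter> order_chamber r) = {y \<in> open_cube. branch a y \<in> order_chamber r}"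
proof (intro equalityI subsetI)
  fix y assume "y \<in> T ` (digit_domain a \<inter> order_chamber r)"
  then show "y \<in> {y \<in> open_cube. branch a y \<in> order_chamber r}"
    using jp_map_digit_domain by auto
next
  fix y assume y: "y \<in> {y \<in> open_cube. branch a y \<in> order_chamber r}"
  then have "branch a y \<in> digit_domain a" "T (branch a y) = y"
    using branch_in_digit_domain[OF assms, of y] chamber_open_cube[of "branch a y" r] by auto
  with y show "y \<in> T ` (digit_domain a \<inter> order_chamber r)" by (metis (mono_tags, lifting) IntI image_eqI mem_Collect_eq)
qed

text \<open>
  Cells are sets, so their digits have to be recovered by choice. A nonempty cell has only one
  digit vector (\<open>digits_unique\<close>).
\<close>

definition cell_digits :: "(real ^ 'm) set \<Rightarrow> 'm \<Rightarrow> int" where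
  "cell_digits S = (SOME a. \<exists>r. S = digit_domain a \<inter> order_chamber r)"

lemma cellE:
  assumes "S \<in> cells"
  obtains r where "S = digit_domain (cell_digits S) \<inter> order_chamber r" "S \<noteq> {}" "admissible_digits (cell_digits S)"
proof -
  from assms obtain a r where "S = digit_domain a \<inter> order_chamber r" "S \<noteq> {}"
    by (auto simp: jp_partition_def)
  then have "\<exists>a r. S = digit_domain a \<inter> order_chamber r" by blast
  then have "\<exists>r. S = digit_domain (cell_digits S) \<inter> order_chamber r" unfolding cell_digits_def by (rule someI_ex)
  with \<open>S \<noteq> {}\<close> show thesis using that digit_domain_admissible by fast
qed

lemma cellI: "x \<in> digit_domain a \<Longrightarrow> x \<in> order_chamber r \<Longrightarrow> digit_domain a \<inter> order_chamber r \<in> cells"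
  by (auto simp: jp_partition_def)

lemma cell_props:
  assumes "S \<in> cells"
  shows "admissible_digits (cell_digits S)" "S \<subseteq> open_cube" "\<And>x. x \<in> S \<Longrightarrow> x \<in> digit_domain (cell_digits S)"
    "\<And>x. x \<in> S \<Longrightarrow> T x \<in> open_cube" "\<And>x. x \<in> S \<Longrightarrow> branch (cell_digits S) (T x) = x"
    "\<And>y. y \<in> open_cube \<Longrightarrow> branch (cell_digits S) y \<in> S \<Longrightarrow> T (branch (cell_digits S) y) = y"
    "T ` S = {y \<in> open_cube. branch (cell_digits S) y \<in> S}"
proof -
  obtain r where S: "S = digit_domain (cell_digits S) \<inter> order_chamber r" "S \<noteq> {}" and d: "admissible_digits (cell_digits S)"
    using cellE[OF assms] .
  show "admissible_digits (cell_digits S)" by fact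
  show oc: "S \<subseteq> open_cube" using S chamber_open_cube by blast
  show dm: "\<And>x. x \<in> S \<Longrightarrow> x \<in> digit_domain (cell_digits S)" using S by blast
  show "\<And>x. x \<in> S \<Longrightarrow> T x \<in> open_cube" "\<And>x. x \<in> S \<Longrightarrow> branch (cell_digits S) (T x) = x"
    using dm jp_map_digit_domain by blast+
  show inv: "\<And>y. y \<in> open_cube \<Longrightarrow> branch (cell_digits S) y \<in> S \<Longrightarrow> T (branch (cell_digits S) y) = y"
    using branch_in_digit_domain[OF d] oc by blast
  show "T ` S = {y \<in> open_cube. branch (cell_digits S) y \<in> S}"
  proof (intro equalityI subsetI)
    fix y assume "y \<in> T ` S"
    then show "y \<in> {y \<in> open_cube. branch (cell_digits S) y \<in> S}" 
      using \<open>\<And>x. x \<in> S \<Longrightarrow> T x \<in> open_cube\<close> \<open>\<And>x. x \<in> S \<Longrightarrow> branch (cell_digits S) (T x) = x\<close> by auto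
  next
    fix y assume "y \<in> {y \<in> open_cube. branch (cell_digits S) y \<in> S}"
    then show "y \<in> T ` S" using inv by (metis (mono_tags, lifting) image_eqI mem_Collect_eq)
  qed
qed

lemma inj_on_cell: "S \<in> cells \<Longrightarrow> inj_on T S"
  by (metis cell_props(5) inj_onI)

section \<open>Images of order chambers\<close>

text \<open>
  Two numerators are compared like the pairs of integer and fractional part, lexicographically;
  the numerator 1 of the first coordinate falls strictly between those with digit 0 and those
  with digit 1.
\<close>

lemma numer_less_numer:
  assumes "y \<in> open_cube"
  shows "numer a y i < numer a y j \<longleftrightarrow>
    (if i = lst then j \<noteq> lst \<and> 1 \<le> a j else if j = lst then a i \<le> 0
     else a i < a j \<or> a i = a j \<and> y $ i < y $ j)"
proof -
  have y: "0 < y $ i" "y $ i < 1" "0 < y $ j" "y $ j < 1" using assms by auto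
  have "y $ i + of_int (a i) < y $ j + of_int (a j) \<longleftrightarrow> a i < a j \<or> a i = a j \<and> y $ i < y $ j"
    using y by (smt (verit) of_int_1 of_int_add of_int_less_iff int_less_real_le)
  moreover have "1 < y $ j + of_int (a j) \<longleftrightarrow> 1 \<le> a j"
    using y by linarith
  moreover have "y $ i + of_int (a i) < 1 \<longleftrightarrow> a i \<le> 0"
    using y by linarith
  ultimately show ?thesis by (auto simp: numer_def)
qed

lemma numer_less_denom:
  assumes "y \<in> open_cube" 
  shows "numer a y i < denom a y \<longleftrightarrow>
    (if i = lst then 1 \<le> a lst else a i < a lst \<or> a i = a lst \<and> y $ i < y $ lst)"
proof -
  have y: "0 < y $ i" "y $ i < 1" "0 < y $ lst" "y $ lst < 1" using assms by auto
  have "y $ i + of_int (a i) < y $ lst + of_int (a lst) \<longleftrightarrow> a i < a lst \<or> a i = a lst \<and> y $ i < y $ lst"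
    using y by (smt (verit) of_int_1 of_int_add of_int_less_iff int_less_real_le)
  moreover have "1 < y $ lst + of_int (a lst) \<longleftrightarrow> 1 \<le> a lst"
    using y by linarith
  ultimately show ?thesis by (auto simp: numer_def denom_def)
qed

lemma numer_pos: "admissible_digits a \<Longrightarrow> y \<in> open_cube \<Longrightarrow> 0 < numer a y i"
  by (auto simp: numer_def admissible_digits_def add_pos_nonneg)

lemma denom_pos: "admissible_digits a \<Longrightarrow> y \<in> open_cube \<Longrightarrow> 0 < denom a y"
  using denom_ge_1[of a y] by (force simp: less_imp_le)

lemma branch_in_open_cube:
  assumes "admissible_digits a" "y \<in> open_cube"
  shows "branch a y \<in> open_cube \<longleftrightarrow> (\<forall>i. numer a y i < denom a y)"
proof -
  have "branch a y \<in> open_cube \<longleftrightarrow> (\<forall>i. 0 < branch a y $ nxt i \<and> branch a y $ nxt i < 1)"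
    using all_nxt[of "\<lambda>j. 0 < branch a y $ j \<and> branch a y $ j < 1"] by simp
  then show ?thesis using numer_pos[OF assms] denom_pos[OF assms] by simp
qed

text \<open>
  Distinctness of the coordinates is part of the order pattern, since distinct coordinates are
  exactly those that are comparable by \<open><\<close>.
\<close>

lemma order_chamber_mono:
  assumes "x \<in> order_chamber r" "x' \<in> open_cube"
    and "\<And>i j. x $ i < x $ j \<longleftrightarrow> x' $ i < x' $ j"
  shows "x' \<in> order_chamber r"
proof -
  have "inj (\<lambda>i. x' $ i)"
  proof (rule injI)
    fix i j assume "x' $ i = x' $ j"
    then have "x $ i = x $ j" using assms(3)[of i j] assms(3)[of j i] by simp
    then show "i = j" using assms(1) by (auto simp: order_chamber_def inj_def)
  qed
  then show ?thesis using assms by (auto simp: order_chamber_def)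
qed

lemma branch_order:
  assumes "admissible_digits a" "y \<in> open_cube"
  shows "branch a y $ nxt i < branch a y $ nxt j \<longleftrightarrow> numer a y i < numer a y j"
  using denom_pos[OF assms] by (simp add: divide_less_cancel)

text \<open>
  The Markov property. By the two comparison lemmas, the order of the coordinates of the image
  depends only on the digits and on the order of the coordinates of the argument.
\<close>

lemma branch_chamber_invariant:
  assumes "admissible_digits a" "y \<in> order_chamber q" "y' \<in> order_chamber q" "branch a y \<in> order_chamber r"
  shows "branch a y' \<in> order_chamber r"
proof -
  have oc: "y \<in> open_cube" "y' \<in> open_cube" "branch a y \<in> open_cube"
    using assms chamber_open_cube by blast+
  have same: "y $ i < y $ j \<longleftrightarrow> y' $ i < y' $ j" for i j
    using assms(2,3) by (auto simp: order_chamber_def)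
  have "branch a y' \<in> open_cube"
    using oc(3) unfolding branch_in_open_cube[OF assms(1) oc(1)] branch_in_open_cube[OF assms(1) oc(2)]
      numer_less_denom[OF oc(1)] numer_less_denom[OF oc(2)] same .
  moreover have "branch a y $ nxt i < branch a y $ nxt j \<longleftrightarrow> branch a y' $ nxt i < branch a y' $ nxt j" for i j
    unfolding branch_order[OF assms(1) oc(1)] branch_order[OF assms(1) oc(2)]
    by (simp only: numer_less_numer[OF oc(1)] numer_less_numer[OF oc(2)] same)
  then have "branch a y $ i < branch a y $ j \<longleftrightarrow> branch a y' $ i < branch a y' $ j" for i j
    by (metis nxt_prv)
  ultimately show ?thesis using order_chamber_mono[OF assms(4)] by blast
qed

lemma chamber_subset_image:
  assumes "S \<in> cells" "T ` S \<inter> order_chamber q \<noteq> {}"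
  shows "order_chamber q \<subseteq> T ` S"
proof -
  obtain r where S: "S = digit_domain (cell_digits S) \<inter> order_chamber r" and d: "admissible_digits (cell_digits S)"
    using cellE[OF assms(1)] .
  have T: "T ` S = {y \<in> open_cube. branch (cell_digits S) y \<in> order_chamber r}"
    using image_cell[OF d, of r] S by simp
  show ?thesis using assms(2) branch_chamber_invariant[OF d] chamber_open_cube
    unfolding T by blast
qed

end

section \<open>Pulling back affine forms\<close>

text \<open>
  A lower bound for the proportion of a new constant coefficient that comes from the old one, and
  the factor by which a block of \<open>m\<close> branches shrinks the gap between the bounds for a coordinate.
\<close>

abbreviation \<delta> :: "nat \<Rightarrow> real" where "\<delta> m \<equiv> 1 / (real m + 1)"
abbreviation \<theta> :: "nat \<Rightarrow> real" where "\<theta> m \<equiv> 1 - \<delta> m ^ m"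

context jacobi_perron begin

definition form_eval :: "real \<times> (real ^ 'm) \<Rightarrow> real ^ 'm \<Rightarrow> real" where
  "form_eval f y = fst f + snd f \<bullet> y"

definition pullback :: "('m \<Rightarrow> int) \<Rightarrow> real \<times> (real ^ 'm) \<Rightarrow> real \<times> (real ^ 'm)" where
  "pullback a f = (fst f * of_int (a lst) + snd f $ first + (\<Sum>i\<in>UNIV - {lst}. snd f $ nxt i * of_int (a i)),
     \<chi> i. if i = lst then fst f else snd f $ nxt i)"

text \<open>
  A form is the pair of its constant term and its coefficient vector. Composing it with a branch
  and clearing the denominator is linear in the form: the constant term becomes the coefficient
  of the last coordinate, and the other coefficients move down by one position.
\<close>

lemma form_eval_pullback:
  assumes "denom a y \<noteq> 0"
  shows "form_eval (pullback a f) y = form_eval f (branch a y) * denom a y"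
proof -
  have "snd f \<bullet> branch a y = (\<Sum>j\<in>UNIV. snd f $ j * branch a y $ j)"
    by (simp add: inner_vec_def)
  also have "\<dots> = (\<Sum>i\<in>UNIV. snd f $ nxt i * branch a y $ nxt i)"
    using bij_nxt by (intro sum.reindex_bij_betw[symmetric]) 
  also have "\<dots> * denom a y = (\<Sum>i\<in>UNIV. snd f $ nxt i * numer a y i)"
    using assms by (simp add: sum_distrib_right)
  also have "\<dots> = snd f $ first + (\<Sum>i\<in>UNIV - {lst}. snd f $ nxt i * (y $ i + of_int (a i)))"
    by (subst sum.remove[of _ lst]) (auto simp: numer_def)
  finally have 1: "(snd f \<bullet> branch a y) * denom a y = 
    snd f $ first + (\<Sum>i\<in>UNIV - {lst}. snd f $ nxt i * (y $ i + of_int (a i)))"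
    by simp
  have "snd (pullback a f) \<bullet> y = (\<Sum>i\<in>UNIV. (if i = lst then fst f else snd f $ nxt i) * y $ i)"
    by (simp add: inner_vec_def pullback_def)
  also have "\<dots> = fst f * y $ lst + (\<Sum>i\<in>UNIV - {lst}. snd f $ nxt i * y $ i)"
    by (subst sum.remove[of _ lst]) auto
  finally have 2: "snd (pullback a f) \<bullet> y = fst f * y $ lst + (\<Sum>i\<in>UNIV - {lst}. snd f $ nxt i * y $ i)" .
  show ?thesis unfolding form_eval_def 2 ring_distribs 1
    by (simp add: pullback_def denom_def ring_distribs sum.distrib)
qed

fun word_branch :: "('m \<Rightarrow> int) list \<Rightarrow> real ^ 'm \<Rightarrow> real ^ 'm" where
  "word_branch [] y = y"
| "word_branch (a # ds) y = branch a (word_branch ds y)"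

fun word_denom :: "('m \<Rightarrow> int) list \<Rightarrow> real ^ 'm \<Rightarrow> real" where
  "word_denom [] y = 1"
| "word_denom (a # ds) y = denom a (word_branch ds y) * word_denom ds y"

fun pullback_word :: "('m \<Rightarrow> int) list \<Rightarrow> real \<times> (real ^ 'm) \<Rightarrow> real \<times> (real ^ 'm)" where
  "pullback_word [] f = f"
| "pullback_word (a # ds) f = pullback_word ds (pullback a f)"

abbreviation "all_admissible ds \<equiv> (\<forall>a\<in>set ds. admissible_digits a)"

lemma word_branch_nonneg: "all_admissible ds \<Longrightarrow> (\<And>i. 0 \<le> y $ i) \<Longrightarrow> 0 \<le> word_branch ds y $ i"
  by (induction ds arbitrary: i) (auto intro!: branch_nonneg)

lemma word_denom_ge_1: "all_admissible ds \<Longrightarrow> (\<And>i. 0 \<le> y $ i) \<Longrightarrow> 1 \<le> word_denom ds y"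
proof (induction ds)
  case (Cons a ds)
  then have "1 \<le> denom a (word_branch ds y)" by (intro denom_ge_1 word_branch_nonneg) auto
  then have "1 * 1 \<le> denom a (word_branch ds y) * word_denom ds y" using Cons by (intro mult_mono) auto
  then show ?case by simp
qed simp

text \<open>
  Each factor of \<open>word_denom\<close> clears the denominator introduced by one branch.
\<close>

lemma form_eval_pullback_word:
  assumes "all_admissible ds" "\<And>i. 0 \<le> y $ i"
  shows "form_eval (pullback_word ds f) y = form_eval f (word_branch ds y) * word_denom ds y"
  using assms(1)
proof (induction ds arbitrary: f)
  case (Cons a ds)
  then have "1 \<le> denom a (word_branch ds y)" using assms by (intro denom_ge_1 word_branch_nonneg) auto
  then show ?case using Cons by (simp add: form_eval_pullback)
qed simp

lemma pullback_word_append: "pullback_word (xs @ ys) f = pullback_word ys (pullback_word xs f)"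
  by (induction xs arbitrary: f) auto

lemma pullback_diff: "pullback a (f - g) = pullback a f - pullback a g"
  by (auto simp: pullback_def vec_eq_iff algebra_simps sum_subtractf)

lemma pullback_scaleR: "pullback a (c *\<^sub>R f) = c *\<^sub>R pullback a f"
  by (auto simp: pullback_def vec_eq_iff algebra_simps sum_distrib_left)

lemma pullback_word_diff: "pullback_word ds (f - g) = pullback_word ds f - pullback_word ds g"
  by (induction ds arbitrary: f g) (auto simp: pullback_diff)

lemma pullback_word_scaleR: "pullback_word ds (c *\<^sub>R f) = c *\<^sub>R pullback_word ds f"
  by (induction ds arbitrary: f) (auto simp: pullback_scaleR)

definition nonneg_form :: "real \<times> (real ^ 'm) \<Rightarrow> bool" where
  "nonneg_form f \<longleftrightarrow> 0 \<le> fst f \<and> (\<forall>i. 0 \<le> snd f $ i)"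

text \<open>
  The denominators of compositions of branches have this property. It says that the denominator
  \<open>q\<^sub>n\<close> of the current convergent, the constant term, is at least as large as the previous ones,
  the coefficients.
\<close>

definition dominated_form :: "real \<times> (real ^ 'm) \<Rightarrow> bool" where
  "dominated_form f \<longleftrightarrow> 0 < fst f \<and> (\<forall>i. 0 \<le> snd f $ i \<and> snd f $ i \<le> fst f)"

lemma dominated_form_nonneg: "dominated_form f \<Longrightarrow> nonneg_form f"
  by (auto simp: dominated_form_def nonneg_form_def)

lemma fst_pullback_ge:
  assumes "admissible_digits a" "nonneg_form f"
  shows "of_int (a lst) * fst f \<le> fst (pullback a f)"
proof -
  have "0 \<le> (\<Sum>i\<in>UNIV - {lst}. snd f $ nxt i * of_int (a i))"
    using assms by (intro sum_nonneg mult_nonneg_nonneg) (auto simp: nonneg_form_def admissible_digits_def)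
  then show ?thesis using assms by (simp add: pullback_def nonneg_form_def mult.commute)
qed

lemma fst_pullback_mono: 
  assumes "admissible_digits a" "nonneg_form f"
  shows "fst f \<le> fst (pullback a f)"
proof -
  have "1 * fst f \<le> of_int (a lst) * fst f" 
    using assms by (intro mult_right_mono) (auto simp: nonneg_form_def admissible_digits_def)
  then show ?thesis using fst_pullback_ge[OF assms] by simp
qed

lemma pullback_nonneg: "admissible_digits a \<Longrightarrow> nonneg_form f \<Longrightarrow> nonneg_form (pullback a f)"
  using fst_pullback_mono[of a f] by (auto simp: nonneg_form_def pullback_def)

lemma pullback_word_nonneg: "all_admissible ds \<Longrightarrow> nonneg_form f \<Longrightarrow> nonneg_form (pullback_word ds f)"
  by (induction ds arbitrary: f) (auto simp: pullback_nonneg)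

lemma pullback_dominated: 
  assumes "admissible_digits a" "dominated_form f"
  shows "dominated_form (pullback a f)"
  using fst_pullback_mono[OF assms(1) dominated_form_nonneg[OF assms(2)]] assms(2)
  by (auto simp: dominated_form_def pullback_def intro: order_trans)

lemma pullback_word_dominated: "all_admissible ds \<Longrightarrow> dominated_form f \<Longrightarrow> dominated_form (pullback_word ds f)"
  by (induction ds arbitrary: f) (auto simp: pullback_dominated)

section \<open>Contraction of compositions of branches\<close>

text \<open>
  There are \<open>m + 1\<close> summands, each at most the largest digit times the constant term.
\<close>

lemma fst_pullback_le:
  assumes "admissible_digits a" "dominated_form f"
  shows "fst (pullback a f) \<le> (real CARD('m) + 1) * (of_int (a lst) * fst f)"
proof -
  have a: "0 \<le> a i" "a i \<le> a lst" "1 \<le> a lst" for i using assms(1) by (auto simp: admissible_digits_def)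
  have f: "0 < fst f" "0 \<le> snd f $ i" "snd f $ i \<le> fst f" for i using assms(2) by (auto simp: dominated_form_def)
  have "(\<Sum>i\<in>UNIV - {lst}. snd f $ nxt i * of_int (a i)) \<le> (\<Sum>i\<in>UNIV - {lst}. fst f * of_int (a lst))"
    using a f by (intro sum_mono mult_mono) auto
  also have "\<dots> = (real CARD('m) - 1) * (fst f * of_int (a lst))"
    using card_ge_2 by (simp add: card_Diff_singleton of_nat_diff)
  finally have "(\<Sum>i\<in>UNIV - {lst}. snd f $ nxt i * of_int (a i)) \<le> (real CARD('m) - 1) * (fst f * of_int (a lst))" .
  moreover have "snd f $ first \<le> fst f * of_int (a lst)"
  proof -
    have "fst f * 1 \<le> fst f * of_int (a lst)" using f(1) a(3) by (intro mult_left_mono) auto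
    then show ?thesis using f(3)[of first] by linarith
  qed
  ultimately show ?thesis by (simp add: pullback_def algebra_simps)
qed

text \<open>
  The old constant term enters the new one with the largest digit as weight, and
  \<open>fst_pullback_le\<close> says that this is at least the proportion \<open>\<delta>\<close> of everything that enters.
\<close>

lemma pullback_minorant:
  assumes "admissible_digits a" "nonneg_form U" "dominated_form V" "0 \<le> k" "k * fst V \<le> fst U"
  shows "\<delta> CARD('m) * k * fst (pullback a V) \<le> fst (pullback a U)"
proof -
  have "\<delta> CARD('m) * k * fst (pullback a V) \<le> \<delta> CARD('m) * k * ((real CARD('m) + 1) * (of_int (a lst) * fst V))"
    using assms by (intro mult_left_mono fst_pullback_le) auto
  also have "\<dots> = of_int (a lst) * (k * fst V)"
    by (simp add: field_simps)
  also have "\<dots> \<le> of_int (a lst) * fst U"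
    using assms by (intro mult_left_mono) (auto simp: admissible_digits_def)
  also have "\<dots> \<le> fst (pullback a U)" using assms by (intro fst_pullback_ge)
  finally show ?thesis .
qed

text \<open>
  The number \<open>n\<close> counts the last coordinates whose coefficients are already known to satisfy the
  bound. Each step moves the constant term into the last coefficient and shifts the other
  coefficients, so \<open>n\<close> grows by one while the constant loses a factor \<open>\<delta>\<close>.
\<close>

lemma pullback_word_minorant:
  assumes "all_admissible ds" "nonneg_form U" "dominated_form V" "0 \<le> k" "k * fst V \<le> fst U"
    and "\<And>i. CARD('m) < pos i + n \<Longrightarrow> k * snd V $ i \<le> snd U $ i"
  shows "\<delta> CARD('m) ^ length ds * k * fst (pullback_word ds V) \<le> fst (pullback_word ds U) \<and>
    (\<forall>i. CARD('m) < pos i + n + length ds \<longrightarrow> \<delta> CARD('m) ^ length ds * k * snd (pullback_word ds V) $ i \<le> snd (pullback_word ds U) $ i)"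
  using assms
proof (induction ds arbitrary: U V k n)
  case (Cons a ds)
  have delta: "0 \<le> \<delta> CARD('m)" "\<delta> CARD('m) \<le> 1" by auto
  have k: "\<delta> CARD('m) * k \<le> k" using delta Cons.prems by (intro mult_left_le_one_le) auto
  have step: "\<delta> CARD('m) * k * snd (pullback a V) $ i \<le> snd (pullback a U) $ i" if "CARD('m) < pos i + Suc n" for i
  proof (cases "i = lst")
    case True
    have "\<delta> CARD('m) * k * fst V \<le> k * fst V"
      using k Cons.prems by (intro mult_right_mono) (auto simp: dominated_form_def)
    then show ?thesis using Cons.prems(5) True by (simp add: pullback_def)
  next
    case False
    have "\<delta> CARD('m) * k * snd V $ nxt i \<le> k * snd V $ nxt i"
      using k Cons.prems by (intro mult_right_mono) (auto simp: dominated_form_def)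
    moreover have "k * snd V $ nxt i \<le> snd U $ nxt i"
      using Cons.prems(6)[of "nxt i"] that False by (simp add: pos_nxt)
    ultimately show ?thesis using False by (simp add: pullback_def)
  qed
  have "\<delta> CARD('m) * k * fst (pullback a V) \<le> fst (pullback a U)"
    using Cons.prems by (intro pullback_minorant) auto
  from Cons.IH[OF _ _ _ _ this, of "Suc n"] step Cons.prems
  show ?case by (auto simp: pullback_nonneg pullback_dominated mult_ac)
qed simp

lemma pullback_word_minorant_block:
  assumes "all_admissible ds" "length ds = CARD('m)" "nonneg_form U" "dominated_form V" "0 \<le> k" "k * fst V \<le> fst U"
  shows "nonneg_form (pullback_word ds U - (\<delta> CARD('m) ^ CARD('m) * k) *\<^sub>R pullback_word ds V)"
proof -
  have no: "\<not> CARD('m) < pos i + 0" for i using pos_le_card[of i] by simp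
  have all: "CARD('m) < pos i + 0 + length ds" for i using pos_ge_1[of i] assms(2) by simp
  have "\<delta> CARD('m) ^ length ds * k * fst (pullback_word ds V) \<le> fst (pullback_word ds U) \<and>
    (\<forall>i. CARD('m) < pos i + 0 + length ds \<longrightarrow>
      \<delta> CARD('m) ^ length ds * k * snd (pullback_word ds V) $ i \<le> snd (pullback_word ds U) $ i)"
    by (rule pullback_word_minorant[OF assms(1,3-6)]) (use no in blast)
  then show ?thesis using all assms(2) by (simp add: nonneg_form_def)
qed

lemma theta_bounds: "0 < \<theta> CARD('m)" "\<theta> CARD('m) < 1"
proof -
  have d: "0 < \<delta> CARD('m)" "\<delta> CARD('m) < 1" using card_ge_2 by auto
  have "\<delta> CARD('m) ^ CARD('m) < 1 ^ CARD('m)" using d by (intro power_strict_mono) auto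
  moreover have "0 < \<delta> CARD('m) ^ CARD('m)" using d by (intro zero_less_power)
  ultimately show "0 < \<theta> CARD('m)" "\<theta> CARD('m) < 1" by auto
qed

text \<open>
  If \<open>v\<close> is the ratio of the constant terms, then \<open>\<beta> D - N\<close> has constant term \<open>(\<beta> - v) D\<^sub>0\<close> and
  \<open>N - \<alpha> D\<close> has constant term \<open>(v - \<alpha>) D\<^sub>0\<close>. After a block of length \<open>m\<close> both exceed \<open>\<delta> ^ m\<close>
  times these multiples of \<open>D\<close> in every coefficient, so the upper bound drops by \<open>\<delta> ^ m (\<beta> - v)\<close>,
  the lower bound rises by \<open>\<delta> ^ m (v - \<alpha>)\<close>, and the gap loses the proportion \<open>\<delta> ^ m\<close>.
\<close>

lemma pullback_word_contraction_block:
  assumes "all_admissible ds" "length ds = CARD('m)" "dominated_form D"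
    and "nonneg_form (N - \<alpha> *\<^sub>R D)" "nonneg_form (\<beta> *\<^sub>R D - N)"
  obtains \<alpha>' \<beta>' where "nonneg_form (pullback_word ds N - \<alpha>' *\<^sub>R pullback_word ds D)" "nonneg_form (\<beta>' *\<^sub>R pullback_word ds D - pullback_word ds N)"
    "\<beta>' - \<alpha>' = \<theta> CARD('m) * (\<beta> - \<alpha>)"
proof -
  define v where "v = fst N / fst D"
  have D: "0 < fst D" using assms(3) by (simp add: dominated_form_def)
  have v: "fst N = v * fst D" using D by (simp add: v_def)
  have v1: "\<alpha> \<le> v" "v \<le> \<beta>"
    using assms(4,5) D unfolding nonneg_form_def by (auto simp: v)
  have "nonneg_form (pullback_word ds (N - \<alpha> *\<^sub>R D) - (\<delta> CARD('m) ^ CARD('m) * (v - \<alpha>)) *\<^sub>R pullback_word ds D)"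
    using assms v1 by (intro pullback_word_minorant_block) (auto simp: v algebra_simps)
  then have 1: "nonneg_form (pullback_word ds N - (\<alpha> + \<delta> CARD('m) ^ CARD('m) * (v - \<alpha>)) *\<^sub>R pullback_word ds D)"
    by (simp add: pullback_word_diff pullback_word_scaleR algebra_simps)
  have "nonneg_form (pullback_word ds (\<beta> *\<^sub>R D - N) - (\<delta> CARD('m) ^ CARD('m) * (\<beta> - v)) *\<^sub>R pullback_word ds D)"
    using assms v1 by (intro pullback_word_minorant_block) (auto simp: v algebra_simps)
  then have 2: "nonneg_form ((\<beta> - \<delta> CARD('m) ^ CARD('m) * (\<beta> - v)) *\<^sub>R pullback_word ds D - pullback_word ds N)"
    by (simp add: pullback_word_diff pullback_word_scaleR algebra_simps)
  show thesis using that[OF 1 2] by (simp add: algebra_simps)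
qed

lemma pullback_word_contraction:
  assumes "all_admissible ds" "k * CARD('m) \<le> length ds" "dominated_form D"
    and "nonneg_form (N - \<alpha> *\<^sub>R D)" "nonneg_form (\<beta> *\<^sub>R D - N)"
  shows "\<exists>\<alpha>' \<beta>'. nonneg_form (pullback_word ds N - \<alpha>' *\<^sub>R pullback_word ds D) \<and> nonneg_form (\<beta>' *\<^sub>R pullback_word ds D - pullback_word ds N) \<and>
    \<beta>' - \<alpha>' = \<theta> CARD('m) ^ k * (\<beta> - \<alpha>)"
  using assms
proof (induction k arbitrary: ds N D \<alpha> \<beta>)
  case 0
  have "nonneg_form (pullback_word ds (N - \<alpha> *\<^sub>R D))" "nonneg_form (pullback_word ds (\<beta> *\<^sub>R D - N))"
    using 0 by (auto intro!: pullback_word_nonneg)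
  then show ?case by (intro exI[of _ \<alpha>] exI[of _ \<beta>]) (auto simp: pullback_word_diff pullback_word_scaleR)
next
  case (Suc k)
  define xs ys where "xs = take CARD('m) ds" and "ys = drop CARD('m) ds"
  have ds: "ds = xs @ ys" by (simp add: xs_def ys_def)
  have xs: "length xs = CARD('m)" using Suc.prems(2) by (simp add: xs_def)
  obtain \<alpha>' \<beta>' where 1: "nonneg_form (pullback_word xs N - \<alpha>' *\<^sub>R pullback_word xs D)" "nonneg_form (\<beta>' *\<^sub>R pullback_word xs D - pullback_word xs N)"
    "\<beta>' - \<alpha>' = \<theta> CARD('m) * (\<beta> - \<alpha>)"
    using pullback_word_contraction_block[of xs D N \<alpha> \<beta>] Suc.prems xs ds by auto
  have "\<exists>\<alpha>'' \<beta>''. nonneg_form (pullback_word ys (pullback_word xs N) - \<alpha>'' *\<^sub>R pullback_word ys (pullback_word xs D)) \<and> 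
     nonneg_form (\<beta>'' *\<^sub>R pullback_word ys (pullback_word xs D) - pullback_word ys (pullback_word xs N)) \<and>
    \<beta>'' - \<alpha>'' = \<theta> CARD('m) ^ k * (\<beta>' - \<alpha>')"
    using Suc.prems ds xs 1 by (intro Suc.IH pullback_word_dominated) auto
  then show ?case unfolding ds pullback_word_append 1(3) by (simp add: mult_ac)
qed

text \<open>
  This form majorises \<open>unit_form\<close> and all coordinate forms; it serves to compare numerators with
  denominators before any coefficient of the denominator is known to be positive.
\<close>

definition ones_form :: "real \<times> (real ^ 'm)" where "ones_form = (1, \<chi> i. 1)"
definition unit_form :: "real \<times> (real ^ 'm)" where "unit_form = (1, 0)"
definition coord_form :: "'m \<Rightarrow> real \<times> (real ^ 'm)" where "coord_form i = (0, axis i 1)"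

lemma dominated_unit_form: "dominated_form unit_form" and dominated_ones_form: "dominated_form ones_form" and nonneg_coord_form: "nonneg_form (coord_form i)"
  by (auto simp: dominated_form_def unit_form_def ones_form_def nonneg_form_def coord_form_def axis_def)

lemma nonneg_ones_minus_coord: "nonneg_form (ones_form - coord_form i)"
  by (auto simp: ones_form_def nonneg_form_def coord_form_def axis_def)

lemma form_eval_unit [simp]: "form_eval unit_form y = 1" and form_eval_coord [simp]: "form_eval (coord_form i) y = y $ i"
  by (auto simp: form_eval_def unit_form_def coord_form_def inner_axis' )

lemma word_denom_eval: "all_admissible ds \<Longrightarrow> (\<And>i. 0 \<le> y $ i) \<Longrightarrow> word_denom ds y = form_eval (pullback_word ds unit_form) y"
  by (simp add: form_eval_pullback_word)

lemma word_branch_nth: 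
  assumes "all_admissible ds" "\<And>i. 0 \<le> y $ i"
  shows "word_branch ds y $ i = form_eval (pullback_word ds (coord_form i)) y / form_eval (pullback_word ds unit_form) y"
  using assms word_denom_ge_1[OF assms] by (simp add: form_eval_pullback_word)

lemma power_delta: "(real CARD('m) + 1) ^ n * (\<delta> CARD('m) ^ n * z) = z"
  by (simp add: power_divide)

lemma power_delta_1: "(real CARD('m) + 1) ^ n * \<delta> CARD('m) ^ n = 1"
  by (simp add: power_divide)

text \<open>
  At the start no multiple of the constant form 1 dominates the coordinate form. A first block of
  length \<open>m\<close> makes the denominator comparable with \<open>ones_form\<close> and yields the initial gap
  \<open>(m + 1) ^ m\<close>; every later block contributes a factor \<open>\<theta>\<close>. Words shorter than a block need only
  the crude bound with \<open>\<alpha> = 0\<close>.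
\<close>

lemma oscillation:
  assumes "all_admissible ds"
  shows "\<exists>\<alpha>. let U = pullback_word ds (coord_form i) - \<alpha> *\<^sub>R pullback_word ds unit_form in
    nonneg_form U \<and> fst U \<le> (real CARD('m) + 1) ^ CARD('m) * \<theta> CARD('m) ^ (length ds div CARD('m) - 1) * fst (pullback_word ds unit_form) \<and>
    (\<forall>j. snd U $ j \<le> (real CARD('m) + 1) ^ CARD('m) * \<theta> CARD('m) ^ (length ds div CARD('m) - 1) * fst (pullback_word ds unit_form))"
proof (cases "length ds < CARD('m)")
  case True
  have no: "\<not> CARD('m) < pos i + 0" for i using pos_le_card[of i] by simp
  have "\<delta> CARD('m) ^ length ds * 1 * fst (pullback_word ds ones_form) \<le> fst (pullback_word ds unit_form) \<and>
    (\<forall>i. CARD('m) < pos i + 0 + length ds \<longrightarrow>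
      \<delta> CARD('m) ^ length ds * 1 * snd (pullback_word ds ones_form) $ i \<le> snd (pullback_word ds unit_form) $ i)"
    by (rule pullback_word_minorant[OF assms dominated_form_nonneg[OF dominated_unit_form] dominated_ones_form])
      (use no in \<open>auto simp: unit_form_def ones_form_def\<close>)
  then have "(real CARD('m) + 1) ^ length ds * (\<delta> CARD('m) ^ length ds * fst (pullback_word ds ones_form)) \<le> (real CARD('m) + 1) ^ length ds * fst (pullback_word ds unit_form)"
    by (intro mult_left_mono) auto
  moreover have "(real CARD('m) + 1) ^ length ds * (\<delta> CARD('m) ^ length ds * fst (pullback_word ds ones_form)) = fst (pullback_word ds ones_form)"
    by (rule power_delta)
  ultimately have "fst (pullback_word ds ones_form) \<le> (real CARD('m) + 1) ^ length ds * fst (pullback_word ds unit_form)" by simp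
  also have "\<dots> \<le> (real CARD('m) + 1) ^ CARD('m) * fst (pullback_word ds unit_form)"
    using pullback_word_dominated[OF assms dominated_unit_form] True
    by (intro mult_right_mono power_increasing) (auto simp: dominated_form_def)
  finally have 1: "fst (pullback_word ds ones_form) \<le> (real CARD('m) + 1) ^ CARD('m) * fst (pullback_word ds unit_form)" .
  have 2: "nonneg_form (pullback_word ds ones_form - pullback_word ds (coord_form i))"
    using pullback_word_nonneg[OF assms nonneg_ones_minus_coord] by (simp add: pullback_word_diff)
  have 3: "dominated_form (pullback_word ds ones_form)" by (intro pullback_word_dominated assms dominated_ones_form)
  have 4: "nonneg_form (pullback_word ds (coord_form i))" by (intro pullback_word_nonneg assms nonneg_coord_form)
  have 5: "snd (pullback_word ds (coord_form i)) $ j \<le> fst (pullback_word ds ones_form)" "fst (pullback_word ds (coord_form i)) \<le> fst (pullback_word ds ones_form)" for j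
    using 2 3 by (auto simp: nonneg_form_def dominated_form_def intro: order_trans)
  show ?thesis
    using 1 4 5 True by (intro exI[of _ 0]) (auto simp: intro: order_trans)
next
  case False
  define xs ys where "xs = take CARD('m) ds" and "ys = drop CARD('m) ds"
  have ds: "ds = xs @ ys" by (simp add: xs_def ys_def)
  have xs: "length xs = CARD('m)" using False by (simp add: xs_def)
  have dl: "all_admissible xs" "all_admissible ys" using assms ds by auto
  define k where "k = length ds div CARD('m) - 1"
  have k: "k * CARD('m) \<le> length ys"
  proof -
    have "(length ds div CARD('m)) * CARD('m) \<le> length ds" by simp
    then show ?thesis using xs by (simp add: k_def ds diff_mult_distrib)
  qed
  have "nonneg_form (pullback_word xs unit_form - (\<delta> CARD('m) ^ CARD('m) * 1) *\<^sub>R pullback_word xs ones_form)"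
    using dl xs dominated_form_nonneg[OF dominated_unit_form] dominated_ones_form
    by (intro pullback_word_minorant_block) (auto simp: unit_form_def ones_form_def)
  then have "nonneg_form ((real CARD('m) + 1) ^ CARD('m) *\<^sub>R (pullback_word xs unit_form - (\<delta> CARD('m) ^ CARD('m)) *\<^sub>R pullback_word xs ones_form))"
    by (auto simp: nonneg_form_def)
  then have "nonneg_form ((real CARD('m) + 1) ^ CARD('m) *\<^sub>R pullback_word xs unit_form - pullback_word xs ones_form)"
    by (simp only: scaleR_diff_right scaleR_scaleR power_delta_1 scaleR_one)
  moreover have "nonneg_form (pullback_word xs ones_form - pullback_word xs (coord_form i))"
    using pullback_word_nonneg[OF dl(1) nonneg_ones_minus_coord] by (simp add: pullback_word_diff)
  ultimately have b: "nonneg_form ((real CARD('m) + 1) ^ CARD('m) *\<^sub>R pullback_word xs unit_form - pullback_word xs (coord_form i))"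
    by (auto simp: nonneg_form_def intro: order_trans)
  have a: "nonneg_form (pullback_word xs (coord_form i) - 0 *\<^sub>R pullback_word xs unit_form)"
    using pullback_word_nonneg[OF dl(1) nonneg_coord_form] by simp
  obtain \<alpha> \<beta> where ab: "nonneg_form (pullback_word ds (coord_form i) - \<alpha> *\<^sub>R pullback_word ds unit_form)"
      "nonneg_form (\<beta> *\<^sub>R pullback_word ds unit_form - pullback_word ds (coord_form i))" "\<beta> - \<alpha> = \<theta> CARD('m) ^ k * (real CARD('m) + 1) ^ CARD('m)"
    using pullback_word_contraction[OF dl(2) k pullback_word_dominated[OF dl(1) dominated_unit_form] a b]
    unfolding ds pullback_word_append by auto
  have D: "dominated_form (pullback_word ds unit_form)" by (intro pullback_word_dominated assms dominated_unit_form)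
  define U where "U = pullback_word ds (coord_form i) - \<alpha> *\<^sub>R pullback_word ds unit_form"
  have "\<beta> = \<alpha> + (real CARD('m) + 1) ^ CARD('m) * \<theta> CARD('m) ^ k" using ab(3) by (simp add: mult.commute)
  then have U: "nonneg_form (((real CARD('m) + 1) ^ CARD('m) * \<theta> CARD('m) ^ k) *\<^sub>R pullback_word ds unit_form - U)"
    using ab(2) by (simp add: U_def algebra_simps)
  have pos: "0 \<le> (real CARD('m) + 1) ^ CARD('m) * \<theta> CARD('m) ^ k" using theta_bounds by (intro mult_nonneg_nonneg) auto
  have "snd U $ j \<le> (real CARD('m) + 1) ^ CARD('m) * \<theta> CARD('m) ^ k * fst (pullback_word ds unit_form)" for j
  proof -
    have "snd U $ j \<le> (real CARD('m) + 1) ^ CARD('m) * \<theta> CARD('m) ^ k * snd (pullback_word ds unit_form) $ j" using U by (simp add: nonneg_form_def)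
    also have "\<dots> \<le> (real CARD('m) + 1) ^ CARD('m) * \<theta> CARD('m) ^ k * fst (pullback_word ds unit_form)"
      using D pos by (intro mult_left_mono) (auto simp: dominated_form_def)
    finally show ?thesis .
  qed
  moreover have "fst U \<le> (real CARD('m) + 1) ^ CARD('m) * \<theta> CARD('m) ^ k * fst (pullback_word ds unit_form)" using U by (simp add: nonneg_form_def)
  ultimately show ?thesis using ab(1) unfolding k_def[symmetric] Let_def
    by (intro exI[of _ \<alpha>]) (auto simp: U_def)
qed

lemma inner_bound:
  fixes u z :: "real ^ 'm"
  assumes "\<And>j. 0 \<le> u $ j" "\<And>j. u $ j \<le> K"
  shows "\<bar>u \<bullet> z\<bar> \<le> real CARD('m) * (K * norm z)"
proof -
  have "\<bar>u \<bullet> z\<bar> \<le> (\<Sum>j\<in>UNIV. \<bar>u $ j * z $ j\<bar>)"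
    unfolding inner_vec_def by simp
  also have "\<dots> \<le> (\<Sum>j\<in>(UNIV::'m set). K * norm z)"
  proof (intro sum_mono)
    fix j show "\<bar>u $ j * z $ j\<bar> \<le> K * norm z"
      using assms[of j] component_le_norm_cart[of z j] by (simp add: abs_mult mult_mono)
  qed
  finally show ?thesis by simp
qed

lemma inner_le_card:
  fixes u y :: "real ^ 'm"
  assumes "\<And>j. 0 \<le> u $ j" "\<And>j. u $ j \<le> K" "\<And>j. 0 \<le> y $ j" "\<And>j. y $ j \<le> 1"
  shows "u \<bullet> y \<le> real CARD('m) * K"
proof -
  have "u $ j * y $ j \<le> K" for j
    using mult_mono[of "u $ j" K "y $ j" 1] assms[of j] by simp
  then have "u \<bullet> y \<le> (\<Sum>j\<in>(UNIV::'m set). K)"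
    unfolding inner_vec_def by (intro sum_mono) simp
  then show ?thesis by simp
qed

lemma form_eval_diff: "form_eval f x - form_eval f y = snd f \<bullet> (x - y)"
  by (simp add: form_eval_def inner_diff_right)

lemma form_eval_ge_fst: "nonneg_form f \<Longrightarrow> (\<And>i. 0 \<le> y $ i) \<Longrightarrow> fst f \<le> form_eval f y"
  by (auto simp: form_eval_def nonneg_form_def inner_vec_def intro!: sum_nonneg)

text \<open>
  Per unit of distance, the numerator varies by at most \<open>m K\<close> times and the denominator by at
  most \<open>m\<close> times \<open>fst D\<close>, and the denominator is at least \<open>fst D\<close>.
\<close>

lemma form_ratio_lipschitz:
  assumes D: "dominated_form D" and U: "nonneg_form U" "fst U \<le> K * fst D" "\<And>j. snd U $ j \<le> K * fst D"
    and x: "\<And>i. 0 \<le> x $ i" and y: "\<And>i. 0 \<le> y $ i" "\<And>i. y $ i \<le> 1"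
  shows "\<bar>form_eval U x / form_eval D x - form_eval U y / form_eval D y\<bar> \<le> real CARD('m) * (real CARD('m) + 2) * K * norm (x - y)"
proof -
  define d where "d = fst D"
  have d: "0 < d" using D by (simp add: dominated_form_def d_def)
  have Dx: "d \<le> form_eval D x" and Dy: "d \<le> form_eval D y"
    using form_eval_ge_fst[OF dominated_form_nonneg[OF D]] x y by (auto simp: d_def)
  have K: "0 \<le> K" using U d by (metis d_def nonneg_form_def order_trans zero_le_mult_iff not_le)
  have dU: "\<bar>form_eval U x - form_eval U y\<bar> \<le> real CARD('m) * (K * d * norm (x - y))"
    unfolding form_eval_diff using U by (intro inner_bound) (auto simp: nonneg_form_def d_def)
  have dD: "\<bar>form_eval D x - form_eval D y\<bar> \<le> real CARD('m) * (d * norm (x - y))"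
    unfolding form_eval_diff using D by (intro inner_bound) (auto simp: dominated_form_def d_def)
  have Uy: "0 \<le> form_eval U y" "form_eval U y \<le> (real CARD('m) + 1) * (K * d)"
  proof -
    show "0 \<le> form_eval U y" using form_eval_ge_fst[OF U(1) y(1)] U(1) by (auto simp: nonneg_form_def)
    have "snd U \<bullet> y \<le> real CARD('m) * (K * d)"
      using U y by (intro inner_le_card) (auto simp: nonneg_form_def d_def)
    then show "form_eval U y \<le> (real CARD('m) + 1) * (K * d)" using U(2) by (simp add: form_eval_def algebra_simps d_def)
  qed
  have ne: "form_eval D x > 0" "form_eval D y > 0" using d Dx Dy by auto
  have eq: "form_eval U x / form_eval D x - form_eval U y / form_eval D y = 
    (form_eval U x - form_eval U y) / form_eval D x - form_eval U y / form_eval D y * ((form_eval D x - form_eval D y) / form_eval D x)"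
    using ne by (simp add: field_simps)
  have 1: "\<bar>(form_eval U x - form_eval U y) / form_eval D x\<bar> \<le> real CARD('m) * (K * norm (x - y))"
  proof -
    have "\<bar>(form_eval U x - form_eval U y) / form_eval D x\<bar> \<le> real CARD('m) * (K * d * norm (x - y)) / d"
      unfolding abs_divide using dU Dx d ne by (intro frac_le) auto
    then show ?thesis using d by (simp add: field_simps)
  qed
  have 2: "\<bar>(form_eval D x - form_eval D y) / form_eval D x\<bar> \<le> real CARD('m) * norm (x - y)"
  proof -
    have "\<bar>(form_eval D x - form_eval D y) / form_eval D x\<bar> \<le> real CARD('m) * (d * norm (x - y)) / d"
      unfolding abs_divide using dD Dx d ne by (intro frac_le) auto
    then show ?thesis using d by (simp add: field_simps)
  qed
  have 3: "\<bar>form_eval U y / form_eval D y\<bar> \<le> (real CARD('m) + 1) * K"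
  proof -
    have "\<bar>form_eval U y / form_eval D y\<bar> \<le> (real CARD('m) + 1) * (K * d) / d"
      unfolding abs_divide using Uy Dy d ne by (intro frac_le) auto
    also have "\<dots> = (real CARD('m) + 1) * K" using d by simp
    finally show ?thesis .
  qed
  have "\<bar>form_eval U x / form_eval D x - form_eval U y / form_eval D y\<bar> \<le> 
    \<bar>(form_eval U x - form_eval U y) / form_eval D x\<bar> + \<bar>form_eval U y / form_eval D y\<bar> * \<bar>(form_eval D x - form_eval D y) / form_eval D x\<bar>"
    unfolding eq abs_mult[symmetric] by (rule abs_triangle_ineq4)
  also have "\<dots> \<le> real CARD('m) * (K * norm (x - y)) + ((real CARD('m) + 1) * K) * (real CARD('m) * norm (x - y))"
    using 1 2 3 K by (intro add_mono mult_mono) auto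
  also have "\<dots> = real CARD('m) * (real CARD('m) + 2) * K * norm (x - y)" by (simp add: algebra_simps)
  finally show ?thesis .
qed

text \<open>
  Subtracting the constant \<open>\<alpha>\<close> of \<open>oscillation\<close> from a coordinate does not change its variation,
  and leaves a quotient with small numerator.
\<close>

lemma word_branch_contraction_blocks:
  assumes "all_admissible ds" and x: "\<And>i. 0 \<le> x $ i" and y: "\<And>i. 0 \<le> y $ i" "\<And>i. y $ i \<le> 1"
  shows "norm (word_branch ds x - word_branch ds y) \<le>
    real CARD('m) * (real CARD('m) * (real CARD('m) + 2) * ((real CARD('m) + 1) ^ CARD('m) * \<theta> CARD('m) ^ (length ds div CARD('m) - 1)) * norm (x - y))"
proof -
  let ?K = "(real CARD('m) + 1) ^ CARD('m) * \<theta> CARD('m) ^ (length ds div CARD('m) - 1)"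
  have D: "dominated_form (pullback_word ds unit_form)" by (intro pullback_word_dominated assms dominated_unit_form)
  have "\<bar>word_branch ds x $ i - word_branch ds y $ i\<bar> \<le> real CARD('m) * (real CARD('m) + 2) * ?K * norm (x - y)" for i
  proof -
    obtain \<alpha> where "let U = pullback_word ds (coord_form i) - \<alpha> *\<^sub>R pullback_word ds unit_form in
    nonneg_form U \<and> fst U \<le> ?K * fst (pullback_word ds unit_form) \<and> (\<forall>j. snd U $ j \<le> ?K * fst (pullback_word ds unit_form))"
      using oscillation[OF assms(1), of i] by blast
    then obtain U where Ud: "U = pullback_word ds (coord_form i) - \<alpha> *\<^sub>R pullback_word ds unit_form" 
      and U: "nonneg_form U" "fst U \<le> ?K * fst (pullback_word ds unit_form)" "\<And>j. snd U $ j \<le> ?K * fst (pullback_word ds unit_form)"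
      unfolding Let_def by blast
    have evU: "form_eval U z = form_eval (pullback_word ds (coord_form i)) z - \<alpha> * form_eval (pullback_word ds unit_form) z" for z
      by (simp add: Ud form_eval_def algebra_simps)
    have b: "word_branch ds z $ i = \<alpha> + form_eval U z / form_eval (pullback_word ds unit_form) z" if "\<And>i. 0 \<le> z $ i" for z
      using that word_denom_ge_1[OF assms(1), of z]
      by (simp add: word_branch_nth[OF assms(1)] evU diff_divide_distrib word_denom_eval[OF assms(1), symmetric])
    show ?thesis using form_ratio_lipschitz[OF D U x y] by (simp add: b[OF x] b[OF y(1)])
  qed
  then have "(\<Sum>i\<in>UNIV. \<bar>(word_branch ds x - word_branch ds y) $ i\<bar>) \<le> (\<Sum>i\<in>(UNIV :: 'm set). real CARD('m) * (real CARD('m) + 2) * ?K * norm (x - y))"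
    by (intro sum_mono) simp
  then show ?thesis using norm_le_l1_cart[of "word_branch ds x - word_branch ds y"] by simp
qed

text \<open>
  The rate \<open>\<rho>\<close> is the \<open>m\<close>-th root of the factor gained per block; the constant \<open>C\<close> absorbs the
  first and the last, incomplete block.
\<close>

lemma word_branch_contraction:
  "\<exists>\<rho> C. 0 < \<rho> \<and> \<rho> < 1 \<and> 0 < C \<and>
    (\<forall>ds x y. all_admissible ds \<longrightarrow> x \<in> unit_cube \<longrightarrow> y \<in> unit_cube \<longrightarrow>
       norm (word_branch ds x - word_branch ds y) \<le> C * \<rho> ^ length ds * norm (x - y))"
proof -
  let ?m = "CARD('m)"
  define \<rho> where "\<rho> = root ?m (\<theta> CARD('m))"
  have \<rho>: "0 < \<rho>" "\<rho> < 1" and \<rho>m: "\<rho> ^ ?m = \<theta> CARD('m)"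
    using theta_bounds real_root_gt_zero[of ?m "\<theta> CARD('m)"] real_root_lt_1_iff[of ?m "\<theta> CARD('m)"]
      real_root_pow_pos2[of ?m "\<theta> CARD('m)"] unfolding \<rho>_def by simp_all
  define C where "C = real CARD('m) * (real CARD('m) * (real CARD('m) + 2) * (real CARD('m) + 1) ^ CARD('m)) / (\<theta> CARD('m))\<^sup>2"
  have C: "0 < C" using theta_bounds card_ge_2 unfolding C_def by (intro divide_pos_pos mult_pos_pos) auto
  \<comment> \<open>The exponent \<open>n div m - 1\<close> falls short of \<open>n / m\<close> by at most 2, whence the factor \<open>1 / \<theta>\<^sup>2\<close>.\<close>
  have key: "\<theta> CARD('m) ^ (n div ?m - 1) \<le> \<rho> ^ n / (\<theta> CARD('m))\<^sup>2" for n
  proof -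
    define k where "k = n div ?m"
    have "n \<le> ?m * (k + 1)" unfolding k_def
      by (metis Suc_eq_plus1 dividend_less_times_div less_imp_le_nat mult_Suc_right zero_less_card_finite add.commute)
    then have "\<rho> ^ (?m * (k + 1)) \<le> \<rho> ^ n" using \<rho> by (intro power_decreasing) auto
    then have 1: "\<theta> CARD('m) ^ (k + 1) \<le> \<rho> ^ n" by (simp only: power_mult \<rho>m)
    have "\<theta> CARD('m) ^ (k - 1) * (\<theta> CARD('m))\<^sup>2 \<le> \<theta> CARD('m) ^ (k + 1)"
      unfolding power_add[symmetric] using theta_bounds by (intro power_decreasing) auto
    with 1 have "\<theta> CARD('m) ^ (k - 1) * (\<theta> CARD('m))\<^sup>2 \<le> \<rho> ^ n" by linarith
    then show ?thesis using theta_bounds by (simp add: k_def pos_le_divide_eq)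
  qed
  show ?thesis
  proof (rule exI[of _ \<rho>], rule exI[of _ C], intro conjI allI impI \<rho> C)
    fix ds and x y :: "real ^ 'm" assume ds: "all_admissible ds" and "x \<in> unit_cube" "y \<in> unit_cube"
    then have "norm (word_branch ds x - word_branch ds y) \<le>
      real CARD('m) * (real CARD('m) * (real CARD('m) + 2) * ((real CARD('m) + 1) ^ CARD('m) * \<theta> CARD('m) ^ (length ds div ?m - 1)) * norm (x - y))"
      by (intro word_branch_contraction_blocks) (auto simp: unit_cube_def)
    also have "\<dots> \<le> real CARD('m) * (real CARD('m) * (real CARD('m) + 2) * ((real CARD('m) + 1) ^ CARD('m) * (\<rho> ^ length ds / (\<theta> CARD('m))\<^sup>2)) * norm (x - y))"
      by (intro mult_left_mono mult_right_mono key) auto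
    also have "\<dots> = C * \<rho> ^ length ds * norm (x - y)" by (simp add: C_def)
    finally show "norm (word_branch ds x - word_branch ds y) \<le> C * \<rho> ^ length ds * norm (x - y)" .
  qed
qed

text \<open>
  The denominator is a dominated form, so its ratio \<open>r\<close> at two points of the cube satisfies
  \<open>\<bar>r - 1\<bar> \<le> m \<bar>x - y\<bar>\<close> and \<open>r \<le> m + 1\<close>; the factorisation of \<open>r ^ (m + 1) - 1\<close> does the rest.
\<close>

lemma word_denom_distortion:
  "\<exists>M>0. \<forall>ds x y. all_admissible ds \<longrightarrow> x \<in> unit_cube \<longrightarrow> y \<in> unit_cube \<longrightarrow>
     \<bar>(word_denom ds y / word_denom ds x) ^ (CARD('m) + 1) - 1\<bar> \<le> M * norm (x - y)"
proof -
  let ?k = "CARD('m) + 1"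
  define M where "M = real ?k * (real CARD('m) + 1) ^ CARD('m) * real CARD('m)"
  have M: "0 < M" using card_ge_2 by (simp add: M_def)
  show ?thesis
  proof (intro exI[of _ M] conjI allI impI M)
    fix ds and x y :: "real ^ 'm" assume ds: "all_admissible ds" and "x \<in> unit_cube" "y \<in> unit_cube"
    then have x: "\<And>i. 0 \<le> x $ i" and y: "\<And>i. 0 \<le> y $ i" "\<And>i. y $ i \<le> 1" by (auto simp: unit_cube_def)
    let ?D = "pullback_word ds unit_form"
    define d where "d = fst ?D"
    have D: "dominated_form ?D" by (intro pullback_word_dominated ds dominated_unit_form)
    then have d: "0 < d" by (simp add: d_def dominated_form_def)
    have wx: "word_denom ds x = form_eval ?D x" and wy: "word_denom ds y = form_eval ?D y" using word_denom_eval[OF ds] x y by auto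
    have Dx: "d \<le> form_eval ?D x" and Dy: "d \<le> form_eval ?D y"
      using form_eval_ge_fst[OF dominated_form_nonneg[OF D]] x y by (auto simp: d_def)
    have "snd ?D \<bullet> y \<le> real CARD('m) * d"
      using D y by (intro inner_le_card) (auto simp: dominated_form_def d_def)
    then have Dy': "form_eval ?D y \<le> (real CARD('m) + 1) * d" by (simp add: form_eval_def algebra_simps d_def)
    define r where "r = word_denom ds y / word_denom ds x"
    have r: "0 \<le> r" "r \<le> real CARD('m) + 1"
    proof -
      show "0 \<le> r" using d Dx Dy by (simp add: r_def wx wy)
      have "r \<le> (real CARD('m) + 1) * d / d" unfolding r_def wx wy using d Dx Dy Dy' by (intro frac_le) auto
      then show "r \<le> real CARD('m) + 1" using d by simp
    qed
    have "\<bar>form_eval ?D y - form_eval ?D x\<bar> \<le> real CARD('m) * (d * norm (y - x))"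
      unfolding form_eval_diff using D by (intro inner_bound) (auto simp: dominated_form_def d_def)
    then have "\<bar>form_eval ?D y - form_eval ?D x\<bar> / form_eval ?D x \<le> real CARD('m) * (d * norm (y - x)) / d"
      using Dx d by (intro frac_le) auto
    moreover have "\<bar>r - 1\<bar> = \<bar>form_eval ?D y - form_eval ?D x\<bar> / form_eval ?D x"
    proof -
      have "r - 1 = (form_eval ?D y - form_eval ?D x) / form_eval ?D x"
        unfolding r_def wx wy using Dx d by (simp add: diff_divide_distrib)
      then show ?thesis using Dx d by simp
    qed
    ultimately have r1: "\<bar>r - 1\<bar> \<le> real CARD('m) * norm (x - y)" using d by (simp add: field_simps norm_minus_commute)
    have pos: "0 \<le> (\<Sum>i<?k. r ^ i)" using r by (intro sum_nonneg zero_le_power)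
    have "r ^ ?k - 1 = (r - 1) * (\<Sum>i<?k. r ^ i)" by (rule power_diff_1_eq)
    then have "\<bar>r ^ ?k - 1\<bar> = \<bar>r - 1\<bar> * (\<Sum>i<?k. r ^ i)"
      using pos by (simp only: abs_mult abs_of_nonneg)
    also have "\<dots> \<le> (real CARD('m) * norm (x - y)) * (\<Sum>i<?k. (real CARD('m) + 1) ^ CARD('m))"
    proof (intro mult_mono r1 sum_mono)
      fix i assume "i \<in> {..<?k}"
      have "r ^ i \<le> (real CARD('m) + 1) ^ i" using r by (intro power_mono)
      also have "\<dots> \<le> (real CARD('m) + 1) ^ CARD('m)" using \<open>i \<in> {..<?k}\<close> by (intro power_increasing) auto
      finally show "r ^ i \<le> (real CARD('m) + 1) ^ CARD('m)" .
    qed (use pos in \<open>simp_all only: mult_nonneg_nonneg of_nat_0_le_iff norm_ge_zero\<close>)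
    also have "\<dots> = M * norm (x - y)" by (simp add: M_def mult_ac del: sum.lessThan_Suc)
    finally show "\<bar>(word_denom ds y / word_denom ds x) ^ ?k - 1\<bar> \<le> M * norm (x - y)" by (simp add: r_def)
  qed
qed

end

section \<open>Jacobians of compositions of branches\<close>

lemma has_derivative_vec:
  fixes f :: "'a::real_normed_vector \<Rightarrow> real ^ 'm::finite"
  assumes "\<And>i. ((\<lambda>x. f x $ i) has_derivative (\<lambda>v. f' v $ i)) (at x within S)"
  shows "(f has_derivative f') (at x within S)"
  unfolding has_derivative_componentwise_within[of f] using assms
  by (auto simp: Basis_vec_def inner_axis)

context jacobi_perron begin

definition branch_deriv :: "('m \<Rightarrow> int) \<Rightarrow> real ^ 'm \<Rightarrow> real ^ 'm \<Rightarrow> real ^ 'm" where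
  "branch_deriv a y v = (\<chi> j. ((if prv j = lst then 0 else v $ prv j) * denom a y - numer a y (prv j) * v $ lst) / (denom a y * denom a y))"

lemma branch_deriv_nxt: "branch_deriv a y v $ nxt i = ((if i = lst then 0 else v $ i) * denom a y - numer a y i * v $ lst) / (denom a y * denom a y)"
  by (simp add: branch_deriv_def)

lemma branch_has_derivative:
  assumes "denom a y \<noteq> 0"
  shows "(branch a has_derivative branch_deriv a y) (at y)"
proof (rule has_derivative_vec)
  fix j
  have n: "((\<lambda>x. numer a x i) has_derivative (\<lambda>v. if i = lst then 0 else v $ i)) (at y)" for i
    unfolding numer_def
    by (cases "i = lst") (auto intro!: derivative_eq_intros bounded_linear_imp_has_derivative bounded_linear_vec_nth)
  have d: "(denom a has_derivative (\<lambda>v. v $ lst)) (at y)"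
    unfolding denom_def[abs_def] by (auto intro!: derivative_eq_intros bounded_linear_imp_has_derivative bounded_linear_vec_nth)
  show "((\<lambda>x. branch a x $ j) has_derivative (\<lambda>v. branch_deriv a y v $ j)) (at y)"
    unfolding branch_def branch_deriv_def by (simp, rule has_derivative_divide'[OF n d assms])
qed

text \<open>
  After the cyclic permutation of the rows, the derivative is a diagonal matrix except for its
  last column. The other entries of that column do not affect the determinant; the diagonal
  consists of \<open>m - 1\<close> entries \<open>1 / t\<close> and one entry \<open>- 1 / t\<^sup>2\<close>.
\<close>

lemma det_branch_deriv:
  assumes "denom a y > 0"
  shows "\<bar>det (matrix (branch_deriv a y))\<bar> = 1 / denom a y ^ (CARD('m) + 1)"
proof -
  let ?t = "denom a y"
  define M where "M = matrix (branch_deriv a y)"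
  define N where "N = (\<chi> i. M $ nxt i)"
  define A :: "real ^ 'm ^ 'm" where "A = (\<chi> i k. if i = k then (if i = lst then - 1 / (?t * ?t) else 1 / ?t) else 0)"
  define x where "x = (\<chi> i. if i = lst then 0 else - numer a y i / (?t * ?t))"
  have t: "?t \<noteq> 0" using assms by simp
  have "nxt permutes UNIV" using bij_nxt by (simp add: permutes_altdef)
  then have "det N = of_int (sign nxt) * det M"
    unfolding N_def by (rule det_permute_rows)
  then have 1: "\<bar>det M\<bar> = \<bar>det N\<bar>" by (simp add: abs_mult sign_def)
  \<comment> \<open>In the transposed matrix the last row is that of \<open>A\<close> plus \<open>x\<close>, a combination of the other rows.\<close>
  have "(\<Sum>j\<in>UNIV - {lst}. (x $ j * ?t) *s row j A) \<in> vec.span {row j A |j. j \<noteq> lst}"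
    by (intro vec.span_sum vec.span_scale vec.span_base) auto
  also have "(\<Sum>j\<in>UNIV - {lst}. (x $ j * ?t) *s row j A) = x"
  proof (subst vec_eq_iff, intro allI)
    fix i
    have "(\<Sum>j\<in>UNIV - {lst}. (x $ j * ?t) *s row j A) $ i = (\<Sum>j\<in>UNIV - {lst}. if j = i then x $ i else 0)"
      unfolding sum_component by (intro sum.cong) (auto simp: row_def A_def t)
    also have "\<dots> = x $ i" by (simp add: x_def)
    finally show "(\<Sum>j\<in>UNIV - {lst}. (x $ j * ?t) *s row j A) $ i = x $ i" .
  qed
  finally have "det (\<chi> k. if k = lst then row lst A + x else row k A) = det A" by (rule det_row_span)
  moreover have "(\<chi> k. if k = lst then row lst A + x else row k A) = transpose N"
    by (auto simp: vec_eq_iff transpose_def N_def M_def matrix_def branch_deriv_nxt row_def A_def x_def axis_def t numer_def)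
  ultimately have "det N = det A" by (metis det_transpose)
  also have "\<dots> = (\<Prod>i\<in>UNIV. A $ i $ i)" by (rule det_diagonal) (simp add: A_def)
  also have "\<dots> = A $ lst $ lst * (\<Prod>i\<in>UNIV - {lst}. A $ i $ i)" by (rule prod.remove) auto
  also have "(\<Prod>i\<in>UNIV - {lst}. A $ i $ i) = (\<Prod>i\<in>UNIV - {lst}. 1 / ?t)"
    by (intro prod.cong) (auto simp: A_def)
  also have "\<dots> = (1 / ?t) ^ (CARD('m) - 1)" by (simp add: card_Diff_singleton)
  finally have "\<bar>det N\<bar> = 1 / (?t * ?t) * (1 / ?t) ^ (CARD('m) - 1)"
    using assms by (simp add: A_def abs_mult)
  also have "\<dots> = (1 / ?t) ^ (2 + (CARD('m) - 1))" by (simp only: power_add) (simp add: power2_eq_square)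
  also have "2 + (CARD('m) - 1) = CARD('m) + 1" using card_ge_2 by simp
  finally show ?thesis using 1 by (simp add: M_def power_divide)
qed

text \<open>
  Chain rule, together with the multiplicativity of the determinant.
\<close>

lemma word_branch_has_derivative:
  assumes "all_admissible ds" "\<And>i. 0 \<le> y $ i"
  shows "\<exists>D. (word_branch ds has_derivative D) (at y) \<and> \<bar>det (matrix D)\<bar> = 1 / word_denom ds y ^ (CARD('m) + 1)"
  using assms(1)
proof (induction ds)
  case Nil
  have "(word_branch [] has_derivative id) (at y)"
    unfolding word_branch.simps[abs_def] id_def by (rule has_derivative_ident)
  then show ?case by (intro exI[of _ id]) (simp add: matrix_id_mat_1)
next
  case (Cons a ds)
  then obtain D where D: "(word_branch ds has_derivative D) (at y)" "\<bar>det (matrix D)\<bar> = 1 / word_denom ds y ^ (CARD('m) + 1)"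
    by auto
  have t: "denom a (word_branch ds y) \<ge> 1" using Cons.prems assms(2) by (intro denom_ge_1 word_branch_nonneg) auto
  let ?E = "branch_deriv a (word_branch ds y)"
  have E: "(branch a has_derivative ?E) (at (word_branch ds y))" using t by (intro branch_has_derivative) auto
  have "(branch a \<circ> word_branch ds has_derivative ?E \<circ> D) (at y)"
    by (rule diff_chain_at[OF D(1) E])
  moreover have b: "branch a \<circ> word_branch ds = word_branch (a # ds)" by auto
  moreover have m: "matrix (?E \<circ> D) = matrix ?E ** matrix D"
    using D(1) E by (intro matrix_compose has_derivative_linear)
  moreover have "\<bar>det (matrix (?E \<circ> D))\<bar> = 1 / word_denom (a # ds) y ^ (CARD('m) + 1)"
    using det_branch_deriv[of a "word_branch ds y"] D(2) t
    unfolding m det_mul abs_mult by (simp add: power_mult_distrib)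
  ultimately show ?case by metis
qed

lemma continuous_on_branch:
  assumes "admissible_digits a"
  shows "continuous_on {y. \<forall>i. 0 \<le> y $ i} (branch a)"
  by (rule has_derivative_continuous_on, rule has_derivative_at_withinI, rule branch_has_derivative)
    (use denom_ge_1[OF assms] in force)

lemma continuous_on_word_branch:
  assumes "all_admissible ds"
  shows "continuous_on {y. \<forall>i. 0 \<le> y $ i} (word_branch ds)"
proof (rule continuous_at_imp_continuous_on, intro ballI)
  fix y :: "real ^ 'm" assume "y \<in> {y. \<forall>i. 0 \<le> y $ i}"
  then show "isCont (word_branch ds) y" 
    using word_branch_has_derivative[OF assms, of y] has_derivative_continuous by blast
qed

section \<open>Cells and chambers as open partitions\<close>

lemma open_cube_first_nonzero: "open_cube \<subseteq> {x. x $ first \<noteq> 0}"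
  by (metis (mono_tags, lifting) less_irrefl mem_Collect_eq subsetI)

lemma quot_continuous_on:
  "continuous_on {x. x $ first \<noteq> 0} (jp_quot e)"
proof -
  have "continuous_on {x :: real ^ 'm. x $ first \<noteq> 0} (\<lambda>x. \<chi> i. (if i = lst then 1 else x $ nxt i) / x $ first)"
  proof (rule continuous_on_vec_lambda)
    fix i
    show "continuous_on {x :: real ^ 'm. x $ first \<noteq> 0} (\<lambda>x. (if i = lst then 1 else x $ nxt i) / x $ first)"
      by (cases "i = lst") (auto intro!: continuous_intros)
  qed
  moreover have "jp_quot e = (\<lambda>x. \<chi> i. (if i = lst then 1 else x $ nxt i) / x $ first)"
    by (simp add: fun_eq_iff vec_eq_iff jp_quot_nth)
  ultimately show ?thesis by simp
qed

lemma continuous_on_cell: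
  assumes "S \<in> cells"
  shows "continuous_on S T"
proof -
  have "continuous_on S (\<lambda>x. jp_quot e x - (\<chi> i. of_int (cell_digits S i)))"
    using cell_props(2)[OF assms] open_cube_first_nonzero
    by (intro continuous_intros continuous_on_subset[OF quot_continuous_on]) blast
  then show ?thesis
    by (rule continuous_on_eq) (use jp_map_digit_domain(1) cell_props(3)[OF assms] in \<open>force simp: vec_eq_iff\<close>)
qed

lemma open_digit_domain: "open (digit_domain a)"
proof -
  have "open (open_cube \<inter> jp_quot e -` {z. \<forall>i. of_int (a i) < z $ i \<and> z $ i < of_int (a i) + 1})"
  proof (rule continuous_open_preimage[OF _ open_open_cube])
    show "continuous_on open_cube (jp_quot e)"
      by (rule continuous_on_subset[OF quot_continuous_on open_cube_first_nonzero])
    have "{z :: real^'m. \<forall>i. of_int (a i) < z $ i \<and> z $ i < of_int (a i) + 1} = box (\<chi> i. of_int (a i)) (\<chi> i. of_int (a i) + 1)"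
      by (auto simp: mem_box_cart)
    then show "open {z :: real^'m. \<forall>i. of_int (a i) < z $ i \<and> z $ i < of_int (a i) + 1}"
      by (simp add: open_box)
  qed
  also have "open_cube \<inter> jp_quot e -` {z. \<forall>i. of_int (a i) < z $ i \<and> z $ i < of_int (a i) + 1} = digit_domain a"
    by (auto simp: jp_digit_domain_def)
  finally show ?thesis .
qed

text \<open>
  A total order is determined by its strict inequalities, which makes a chamber a finite
  intersection of open half-spaces.
\<close>

lemma order_chamber_conv:
  assumes "x \<in> order_chamber r"
  shows "order_chamber r = {y \<in> open_cube. \<forall>i j. x $ i < x $ j \<longrightarrow> y $ i < y $ j}"
proof (intro equalityI subsetI)
  fix y assume "y \<in> order_chamber r"
  then show "y \<in> {y \<in> open_cube. \<forall>i j. x $ i < x $ j \<longrightarrow> y $ i < y $ j}"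
    using assms by (auto simp: order_chamber_def)
next
  fix y assume y: "y \<in> {y \<in> open_cube. \<forall>i j. x $ i < x $ j \<longrightarrow> y $ i < y $ j}"
  have "x $ i < x $ j \<longleftrightarrow> y $ i < y $ j" for i j
  proof -
    have "i = j \<or> x $ i < x $ j \<or> x $ j < x $ i" using assms by (auto simp: order_chamber_def inj_def)
    then show ?thesis using y by force
  qed
  then show "y \<in> order_chamber r" using order_chamber_mono[OF assms] y by blast
qed

lemma open_order_chamber: "open (order_chamber r :: (real ^ 'm) set)"
proof (cases "order_chamber r = ({} :: (real ^ 'm) set)")
  case False
  then obtain x :: "real ^ 'm" where x: "x \<in> order_chamber r" by blast
  have "{y \<in> open_cube. \<forall>i j. x $ i < x $ j \<longrightarrow> y $ i < y $ j} =
    open_cube \<inter> (\<Inter>i. \<Inter>j. {y. x $ i < x $ j \<longrightarrow> y $ i < y $ j})" by auto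
  also have "open \<dots>"
  proof (intro open_Int open_open_cube open_INT ballI)
    fix i j show "open {y :: real ^ 'm. x $ i < x $ j \<longrightarrow> y $ i < y $ j}"
      by (cases "x $ i < x $ j") (auto intro!: open_Collect_less continuous_intros)
  qed auto
  finally show ?thesis unfolding order_chamber_conv[OF x] .
qed simp

lemma open_cell: "S \<in> cells \<Longrightarrow> open S"
  by (auto simp: jp_partition_def intro!: open_Int open_digit_domain open_order_chamber)

end

lemma negligible_coord_relation:
  fixes i j :: "'m::finite"
  assumes "i \<noteq> j"
  shows "negligible {x :: real ^ 'm. x $ i = c * x $ j}"
proof -
  have "axis i 1 - c *\<^sub>R axis j 1 \<noteq> (0 :: real ^ 'm)"
    using assms by (auto simp: vec_eq_iff axis_def intro!: exI[of _ i])
  then have "negligible {x :: real ^ 'm. (axis i 1 - c *\<^sub>R axis j 1) \<bullet> x = 0}"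
    by (intro negligible_hyperplane) auto
  moreover have "{x :: real ^ 'm. (axis i 1 - c *\<^sub>R axis j 1) \<bullet> x = 0} = {x. x $ i = c * x $ j}"
    by (auto simp: inner_diff_left inner_axis')
  ultimately show ?thesis by simp
qed

lemma negligible_coord_const:
  "negligible {x :: real ^ 'm::finite. x $ i = c}"
proof -
  have "negligible {x :: real ^ 'm. axis i 1 \<bullet> x = c}"
    by (intro negligible_hyperplane) (auto simp: axis_eq_0_iff)
  then show ?thesis by (simp add: inner_axis')
qed

lemma negligible_coord_eq:
  "i \<noteq> j \<Longrightarrow> negligible {x :: real ^ 'm::finite. x $ i = x $ j}"
  using negligible_coord_relation[of i j 1] by simp

lemma closure_Union_finite:
  "finite \<Q> \<Longrightarrow> closure (\<Union>\<Q>) = (\<Union>Q\<in>\<Q>. closure Q)"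
  by (induction \<Q> rule: finite_induct) auto

context jacobi_perron begin

text \<open>
  The covering condition follows from the other ones: a nonempty open set is not negligible, so a
  subset of full measure is dense.
\<close>

lemma open_partition_mod_nullI:
  assumes "\<And>S. S \<in> \<P> \<Longrightarrow> open S \<and> S \<noteq> {} \<and> S \<subseteq> open_cube" "pairwise disjnt \<P>"
    and neg: "negligible (unit_cube - \<Union>\<P>)"
  shows "open_partition_mod_null (unit_cube :: (real ^ 'm) set) \<P>"
  unfolding open_partition_mod_null_def
proof (intro conjI ballI)
  have "open_cube \<subseteq> closure (\<Union>\<P>)"
  proof (rule ccontr)
    assume "\<not> open_cube \<subseteq> closure (\<Union>\<P>)"
    then have "open_cube - closure (\<Union>\<P>) \<noteq> {}" by blast
    moreover have "open (open_cube - closure (\<Union>\<P>))" by (intro open_Diff open_open_cube closed_closure)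
    ultimately have "\<not> negligible (open_cube - closure (\<Union>\<P>))" using open_not_negligible by blast
    moreover have "open_cube - closure (\<Union>\<P>) \<subseteq> unit_cube - \<Union>\<P>"
      using open_cube_subset closure_subset by blast
    ultimately show False using neg negligible_subset by blast
  qed
  then have "closure open_cube \<subseteq> closure (\<Union>\<P>)" by (simp add: closure_minimal)
  moreover have "closure (\<Union>\<P>) \<subseteq> closure open_cube" using assms(1) by (intro closure_mono) blast
  ultimately show "closure (\<Union>\<P>) = unit_cube" unfolding closure_open_cube by blast
qed (use assms open_cube_subset in blast)+

definition chambers :: "(real ^ 'm) set set" where
  "chambers = range order_chamber - {{}}"

lemma finite_chambers: "finite chambers"
  by (simp add: chambers_def)

lemma chamber_rel: "x \<in> order_chamber r \<Longrightarrow> r = {(i, j). x $ i < x $ j}"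
  by (auto simp: order_chamber_def)

lemma in_own_chamber: "x \<in> open_cube \<Longrightarrow> inj (\<lambda>i. x $ i) \<Longrightarrow> x \<in> order_chamber {(i, j). x $ i < x $ j}"
  by (auto simp: order_chamber_def)

lemma chambers_disjoint: "pairwise disjnt chambers"
  unfolding chambers_def pairwise_def disjnt_def using chamber_rel by blast

lemma digits_unique:
  assumes "x \<in> digit_domain a" "x \<in> digit_domain a'"
  shows "a = a'"
proof
  fix i
  have "of_int (a i) < jp_quot e x $ i" "jp_quot e x $ i < of_int (a i) + 1"
    "of_int (a' i) < jp_quot e x $ i" "jp_quot e x $ i < of_int (a' i) + 1"
    using assms by (auto simp: jp_digit_domain_def)
  then show "a i = a' i" by linarith
qed

lemma cells_disjoint: "pairwise disjnt cells"
proof (rule pairwiseI)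
  fix S S' assume S: "S \<in> cells" "S' \<in> cells" "S \<noteq> S'"
  show "disjnt S S'"
  proof (rule ccontr)
    assume "\<not> disjnt S S'"
    then obtain x where x: "x \<in> S" "x \<in> S'" by (auto simp: disjnt_def)
    obtain a r where 1: "S = digit_domain a \<inter> order_chamber r" using S by (auto simp: jp_partition_def)
    obtain a' r' where 2: "S' = digit_domain a' \<inter> order_chamber r'" using S by (auto simp: jp_partition_def)
    have "r = r'" using x 1 2 chamber_rel by blast
    moreover have "a = a'" using x 1 2 digits_unique by blast
    ultimately show False using S 1 2 by simp
  qed
qed

lemma negligible_non_open_cube: "negligible (unit_cube - open_cube)"
proof (rule negligible_subset)
  show "negligible ((\<Union>i. {x. x $ i = 0} \<union> {x :: real ^ 'm. x $ i = 1}))"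
    by (intro negligible_Union) (auto intro!: negligible_Un negligible_coord_const)
  show "unit_cube - open_cube \<subseteq> (\<Union>i. {x. x $ i = 0} \<union> {x :: real ^ 'm. x $ i = 1})"
    by (auto simp: unit_cube_def not_less) (metis less_eq_real_def order_antisym_conv)+
qed

lemma negligible_non_chamber: "negligible (unit_cube - \<Union>chambers)"
proof (rule negligible_subset)
  show "negligible ((unit_cube - open_cube) \<union> (\<Union>p\<in>{(i, j). i \<noteq> j}. {x :: real ^ 'm. x $ fst p = x $ snd p}))"
    by (intro negligible_Un negligible_non_open_cube negligible_Union) 
      (auto intro!: negligible_coord_eq)
  show "unit_cube - \<Union>chambers \<subseteq> (unit_cube - open_cube) \<union> (\<Union>p\<in>{(i, j). i \<noteq> j}. {x :: real ^ 'm. x $ fst p = x $ snd p})"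
  proof
    fix x :: "real ^ 'm" assume x: "x \<in> unit_cube - \<Union>chambers"
    show "x \<in> (unit_cube - open_cube) \<union> (\<Union>p\<in>{(i, j). i \<noteq> j}. {x :: real ^ 'm. x $ fst p = x $ snd p})"
    proof (cases "x \<in> open_cube \<and> inj (\<lambda>i. x $ i)")
      case True
      then have "x \<in> \<Union>chambers" using in_own_chamber[of x] by (auto simp: chambers_def)
      then show ?thesis using x by blast
    next
      case False
      then consider "x \<notin> open_cube" | i j where "i \<noteq> j" "x $ i = x $ j" unfolding inj_def by blast
      then show ?thesis
      proof cases
        case 2
        then have "x \<in> (\<Union>p\<in>{(i, j). i \<noteq> j}. {x :: real ^ 'm. x $ fst p = x $ snd p})"
          by (intro UN_I[of "(i, j)"]) auto
        then show ?thesis by blast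
      qed (use x in blast)
    qed
  qed
qed

lemma chambers_partition: "open_partition_mod_null unit_cube chambers"
proof (rule open_partition_mod_nullI)
  show "\<And>S. S \<in> chambers \<Longrightarrow> open S \<and> S \<noteq> {} \<and> S \<subseteq> open_cube"
    using open_order_chamber chamber_open_cube by (auto simp: chambers_def)
qed (rule chambers_disjoint negligible_non_chamber)+

text \<open>
  A generic point of a chamber fails to lie in a cell only if some quotient is an integer, that
  is, on countably many hyperplanes.
\<close>

lemma negligible_non_cells: "negligible (unit_cube - \<Union>cells)"
proof (rule negligible_subset)
  let ?N = "(\<Union>p\<in>{p :: 'm \<times> int. fst p \<noteq> first}. {x :: real ^ 'm. x $ fst p = of_int (snd p) * x $ first})"
  let ?N' = "(\<Union>n :: int. {x :: real ^ 'm. x $ first = 1 / of_int n})"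
  have "negligible ?N"
    by (rule negligible_countable_Union) (auto intro!: negligible_coord_relation)
  moreover have "negligible ?N'"
    by (rule negligible_countable_Union) (auto intro!: negligible_coord_const)
  ultimately show "negligible ((unit_cube - \<Union>chambers) \<union> ?N \<union> ?N')"
    by (intro negligible_Un negligible_non_chamber)
  show "unit_cube - \<Union>cells \<subseteq> (unit_cube - \<Union>chambers) \<union> ?N \<union> ?N'"
  proof (rule ccontr)
    assume "\<not> unit_cube - \<Union>cells \<subseteq> (unit_cube - \<Union>chambers) \<union> ?N \<union> ?N'"
    then obtain x where x: "x \<in> unit_cube" "x \<notin> \<Union>cells" "x \<in> \<Union>chambers" "x \<notin> ?N" "x \<notin> ?N'" by blast
    then obtain r where r: "x \<in> order_chamber r" by (auto simp: chambers_def)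
    then have oc: "x \<in> open_cube" by (rule chamber_open_cube)
    define a where "a i = \<lfloor>jp_quot e x $ i\<rfloor>" for i
    have x1: "0 < x $ first" using oc by blast
    have "jp_quot e x $ i \<noteq> of_int n" for i n
    proof
      assume *: "jp_quot e x $ i = of_int n"
      show False
      proof (cases "i = lst")
        case True
        then have "1 / x $ first = of_int n" using * by (simp add: jp_quot_nth)
        then have "x $ first = 1 / of_int n" using x1 by (metis divide_divide_eq_right div_by_1 mult_1)
        then show False using x(5) by blast
      next
        case False
        then have "x $ nxt i / x $ first = of_int n" using * by (simp add: jp_quot_nth)
        then have "x $ nxt i = of_int n * x $ first" using x1 by (simp add: field_simps)
        moreover have "nxt i \<noteq> first" using False by simp
        ultimately have "x \<in> {x. x $ fst (nxt i, n) = of_int (snd (nxt i, n)) * x $ first}" "(nxt i, n) \<in> {p. fst p \<noteq> first}"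
          by auto
        then show False using x(4) by blast
      qed
    qed
    then have "of_int (a i) < jp_quot e x $ i" "jp_quot e x $ i < of_int (a i) + 1" for i
      unfolding a_def by (metis less_eq_real_def of_int_floor_le) linarith
    then have "x \<in> digit_domain a" using oc by (auto simp: jp_digit_domain_def)
    then have "x \<in> \<Union>cells" using r cellI by blast
    then show False using x(2) by blast
  qed
qed

lemma cells_partition: "open_partition_mod_null unit_cube cells"
proof (rule open_partition_mod_nullI)
  show "\<And>S. S \<in> cells \<Longrightarrow> open S \<and> S \<noteq> {} \<and> S \<subseteq> open_cube"
    using open_cell cell_props(2) by (auto simp: jp_partition_def)
qed (rule cells_disjoint negligible_non_cells)+

lemma countable_cells: "countable cells"
proof -
  have "countable (UNIV :: ('m \<Rightarrow> int) set)"
    using countable_PiE[of "UNIV :: 'm set" "\<lambda>_. UNIV :: int set"] by (simp add: PiE_UNIV_domain)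
  then have "countable ((\<lambda>(a, r). digit_domain a \<inter> order_chamber r) ` (UNIV \<times> UNIV :: (('m \<Rightarrow> int) \<times> ('m \<times> 'm) set) set))"
    by (intro countable_image countable_SIGMA) (auto intro: uncountable_infinite)
  moreover have "cells \<subseteq> (\<lambda>(a, r). digit_domain a \<inter> order_chamber r) ` (UNIV \<times> UNIV)"
    by (auto simp: jp_partition_def)
  ultimately show ?thesis by (rule countable_subset[rotated])
qed

lemma T_unit_cube: "T \<in> unit_cube \<rightarrow> unit_cube"
  by (auto simp: unit_cube_def jp_map_def frac_ge_0 less_imp_le[OF frac_lt_1])

lemma dense_cells:
  assumes "open U" "U \<inter> open_cube \<noteq> {}"
  obtains S where "S \<in> cells" "U \<inter> S \<noteq> {}"
proof -
  have "closure (\<Union>cells) = unit_cube" using cells_partition by (simp add: open_partition_mod_null_def)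
  then have "U \<inter> closure (\<Union>cells) \<noteq> {}" using assms(2) open_cube_subset by blast
  then have "U \<inter> \<Union>cells \<noteq> {}" using open_Int_closure_eq_empty[OF assms(1)] by blast
  then show thesis using that by blast
qed

lemma dense_chambers:
  assumes "open U" "U \<inter> open_cube \<noteq> {}"
  obtains x q where "x \<in> U" "x \<in> order_chamber q"
proof -
  have "closure (\<Union>chambers) = unit_cube" using chambers_partition by (simp add: open_partition_mod_null_def)
  then have "U \<inter> closure (\<Union>chambers) \<noteq> {}" using assms(2) open_cube_subset by blast
  then have "U \<inter> \<Union>chambers \<noteq> {}" using open_Int_closure_eq_empty[OF assms(1)] by blast
  then show thesis using that by (auto simp: chambers_def)
qed

section \<open>The Markov partition\<close>

lemma open_image_cell:
  assumes "S \<in> cells" "open U"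
  shows "open (T ` (U \<inter> S))"
proof -
  have d: "admissible_digits (cell_digits S)" using cell_props(1) assms by blast
  have "T ` (U \<inter> S) = open_cube \<inter> branch (cell_digits S) -` (U \<inter> S)"
  proof (intro equalityI subsetI)
    fix y assume "y \<in> T ` (U \<inter> S)"
    then obtain x where x: "x \<in> U" "x \<in> S" "y = T x" by blast
    then show "y \<in> open_cube \<inter> branch (cell_digits S) -` (U \<inter> S)"
      using cell_props(4,5)[OF assms(1) x(2)] by simp
  next
    fix y assume y: "y \<in> open_cube \<inter> branch (cell_digits S) -` (U \<inter> S)"
    then have "y = T (branch (cell_digits S) y)" using cell_props(6)[OF assms(1), of y] by simp
    then show "y \<in> T ` (U \<inter> S)" using y by blast
  qed
  also have "open \<dots>"
    by (intro continuous_open_preimage open_open_cube open_Int assms open_cell)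
      (rule continuous_on_subset[OF continuous_on_branch[OF d]], auto simp: less_imp_le)
  finally show ?thesis .
qed

text \<open>
  The image is open, the chambers are dense, and every chamber that meets the image is contained
  in it.
\<close>

lemma closure_image_cell:
  assumes "S \<in> cells"
  shows "\<exists>\<Q>\<subseteq>chambers. closure (T ` S) = (\<Union>Q\<in>\<Q>. closure Q)"
proof -
  let ?Q = "{Q \<in> chambers. Q \<subseteq> T ` S}"
  have op: "open (T ` S)" using open_image_cell[OF assms open_UNIV] by simp
  have "T ` S \<subseteq> closure (\<Union>?Q)"
  proof
    fix y assume y: "y \<in> T ` S"
    show "y \<in> closure (\<Union>?Q)" unfolding closure_iff_nhds_not_empty
    proof (intro allI impI)
      fix A U :: "(real ^ 'm) set" assume U: "U \<subseteq> A" "open U" "y \<in> U"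
      have "T ` S \<subseteq> open_cube" using cell_props(4)[OF assms] by blast
      then have "(U \<inter> T ` S) \<inter> open_cube \<noteq> {}" using y U by blast
      then obtain x q where "x \<in> U \<inter> T ` S" "x \<in> order_chamber q"
        using dense_chambers[of "U \<inter> T ` S"] op U by blast
      moreover from this have "order_chamber q \<in> ?Q"
        using chamber_subset_image[OF assms, of q] by (auto simp: chambers_def)
      ultimately show "\<Union>?Q \<inter> A \<noteq> {}" using U by blast
    qed
  qed
  then have "closure (T ` S) \<subseteq> closure (\<Union>?Q)" by (simp add: closure_minimal)
  moreover have "closure (\<Union>?Q) \<subseteq> closure (T ` S)" by (intro closure_mono) blast
  moreover have "closure (\<Union>?Q) = (\<Union>Q\<in>?Q. closure Q)"
    by (rule closure_Union_finite) (simp add: finite_chambers)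
  ultimately show ?thesis by (intro exI[of _ ?Q]) auto
qed

lemma cell_subset_chamber:
  assumes "S \<in> cells" "x \<in> S" "x \<in> order_chamber q"
  shows "S \<subseteq> order_chamber q"
  using assms chamber_rel by (auto simp: jp_partition_def)

text \<open>
  The inverse branch of a cell maps every chamber in its domain into the cell, hence into the
  unique chamber that contains the cell.
\<close>

lemma markov_partition: "finite_markov_partition unit_cube T cells chambers"
  unfolding finite_markov_partition_def
proof (intro conjI ballI impI)
  show "finite chambers" "open_partition_mod_null unit_cube chambers"
    by (rule finite_chambers chambers_partition)+
  fix S assume S: "S \<in> cells"
  then show "\<exists>\<Q>\<subseteq>chambers. closure (T ` S) = (\<Union>Q\<in>\<Q>. closure Q)" by (rule closure_image_cell)
  fix P assume P: "P \<in> chambers"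
  then obtain q where q: "P = order_chamber q" "P \<noteq> {}" by (auto simp: chambers_def)
  show "S \<subseteq> P" if "S \<inter> P \<noteq> {}" using that cell_subset_chamber[OF S] q by blast
  show "P \<subseteq> T ` S \<and> (\<exists>!P'. P' \<in> chambers \<and> the_inv_into S T ` P \<subseteq> P' \<inter> S) \<or>
        the_inv_into S T ` (P \<inter> T ` S) \<inter> unit_cube = {}"
  proof (cases "T ` S \<inter> P = {}")
    case False
    then have sub: "P \<subseteq> T ` S" using chamber_subset_image[OF S] q by simp
    obtain r where r: "S = digit_domain (cell_digits S) \<inter> order_chamber r" "S \<noteq> {}" using cellE[OF S] .
    have R: "order_chamber r \<in> chambers" "S \<subseteq> order_chamber r" using r by (auto simp: chambers_def)
    have im: "the_inv_into S T ` P \<subseteq> S"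
      using the_inv_into_into[OF inj_on_cell[OF S]] sub by blast
    have uniq: "P' = order_chamber r" if "P' \<in> chambers \<and> the_inv_into S T ` P \<subseteq> P' \<inter> S" for P'
    proof -
      have "\<not> disjnt P' (order_chamber r)" using that q(2) R(2) by (auto simp: disjnt_def)
      then show ?thesis using pairwiseD[OF chambers_disjoint] that R(1) by metis
    qed
    have "order_chamber r \<in> chambers \<and> the_inv_into S T ` P \<subseteq> order_chamber r \<inter> S"
      using R im by (meson Int_greatest order_trans)
    then have "\<exists>!P'. P' \<in> chambers \<and> the_inv_into S T ` P \<subseteq> P' \<inter> S"
      using uniq by (rule ex1I)
    with sub show ?thesis by (rule disjI1[OF conjI])
  next
    case True
    then have "P \<inter> T ` S = {}" by blast
    then show ?thesis by simp
  qed
qed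

end

section \<open>The extension to the closure of a cell\<close>

lemma has_derivative_vec_nth: "((\<lambda>x. x $ i) has_derivative (\<lambda>v. v $ i)) F"
  by (rule bounded_linear_imp_has_derivative[OF bounded_linear_vec_nth])

context jacobi_perron begin

definition quot_deriv :: "real ^ 'm \<Rightarrow> real ^ 'm \<Rightarrow> real ^ 'm" where
  "quot_deriv x v = (\<chi> i. ((if i = lst then 0 else v $ nxt i) * x $ first - (if i = lst then 1 else x $ nxt i) * v $ first) / (x $ first * x $ first))"

lemma jp_quot_has_derivative:
  assumes "x $ first \<noteq> 0"
  shows "(jp_quot e has_derivative quot_deriv x) (at x within S)"
proof (rule has_derivative_vec)
  fix i
  have n: "((\<lambda>x. if i = lst then 1 else x $ nxt i) has_derivative (\<lambda>v. if i = lst then 0 else v $ nxt i)) (at x within S)"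
    by (cases "i = lst") (auto intro!: has_derivative_vec_nth)
  show "((\<lambda>x. jp_quot e x $ i) has_derivative (\<lambda>v. quot_deriv x v $ i)) (at x within S)"
    unfolding jp_quot_nth quot_deriv_def vec_lambda_beta
    by (rule has_derivative_divide'[OF n has_derivative_vec_nth assms])
qed

lemma quot_deriv_alt: 
  assumes "x $ first \<noteq> 0"
  shows "quot_deriv x v $ i = (if i = lst then 0 else v $ nxt i) * inverse (x $ first) 
    - (if i = lst then 1 else x $ nxt i) * (inverse (x $ first))\<^sup>2 * v $ first"
  using assms by (simp add: quot_deriv_def field_simps power2_eq_square)

lemma inverse_diff_bound:
  fixes p q c d R N :: real
  assumes "0 < p" "0 < q" "inverse p \<le> R" "inverse q \<le> R" "\<bar>p - q\<bar> \<le> N" "\<bar>c - d\<bar> \<le> N" "0 \<le> d" "d \<le> 1"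
  shows "\<bar>inverse p - inverse q\<bar> \<le> R\<^sup>2 * N"
    and "\<bar>c * (inverse p)\<^sup>2 - d * (inverse q)\<^sup>2\<bar> \<le> (R\<^sup>2 + 2 * R ^ 3) * N"
proof -
  define u w where "u = inverse p" and "w = inverse q"
  have u: "0 < u" "u \<le> R" and w: "0 < w" "w \<le> R" using assms by (auto simp: u_def w_def)
  have N: "0 \<le> N" using assms(5) by linarith
  have "u - w = u * w * (q - p)" using assms by (simp add: u_def w_def field_simps)
  then have "\<bar>u - w\<bar> = u * w * \<bar>p - q\<bar>" using u w by (simp add: abs_mult abs_minus_commute)
  also have "\<dots> \<le> (R * R) * N" using u w assms by (intro mult_mono) auto
  finally have uw: "\<bar>u - w\<bar> \<le> R\<^sup>2 * N" by (simp add: power2_eq_square)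
  then show "\<bar>inverse p - inverse q\<bar> \<le> R\<^sup>2 * N" by (simp add: u_def w_def)
  have "c * u\<^sup>2 - d * w\<^sup>2 = (c - d) * u\<^sup>2 + d * ((u - w) * (u + w))"
    by (simp add: power2_eq_square algebra_simps)
  then have "\<bar>c * u\<^sup>2 - d * w\<^sup>2\<bar> \<le> \<bar>c - d\<bar> * u\<^sup>2 + d * (\<bar>u - w\<bar> * (u + w))"
    using u w assms(7) abs_triangle_ineq[of "(c - d) * u\<^sup>2" "d * ((u - w) * (u + w))"] by (simp add: abs_mult)
  also have "\<dots> \<le> N * R\<^sup>2 + 1 * ((R\<^sup>2 * N) * (2 * R))"
    using assms u w uw N by (intro add_mono mult_mono power_mono) auto
  also have "\<dots> = (R\<^sup>2 + 2 * R ^ 3) * N" by (simp add: algebra_simps power2_eq_square power3_eq_cube)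
  finally show "\<bar>c * (inverse p)\<^sup>2 - d * (inverse q)\<^sup>2\<bar> \<le> (R\<^sup>2 + 2 * R ^ 3) * N" 
    by (simp add: u_def w_def)
qed

text \<open>
  A cell with last digit \<open>a\<^sub>m\<close> stays away from the face \<open>x\<^sub>1 = 0\<close>: on it \<open>R = a\<^sub>m + 1\<close> bounds
  \<open>1 / x\<^sub>1\<close>. The entries of the derivative are polynomials in \<open>1 / x\<^sub>1\<close> and the coordinates,
  hence Lipschitz there.
\<close>

lemma quot_deriv_lipschitz:
  assumes x: "x \<in> unit_cube" "0 < x $ first" "inverse (x $ first) \<le> R"
    and y: "y \<in> unit_cube" "0 < y $ first" "inverse (y $ first) \<le> R"
  shows "norm (quot_deriv x v - quot_deriv y v) \<le> real CARD('m) * (2 * R\<^sup>2 + 2 * R ^ 3) * norm (x - y) * norm v"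
proof -
  have c: "\<bar>x $ i - y $ i\<bar> \<le> norm (x - y)" for i
    using component_le_norm_cart[of "x - y" i] by simp
  have "\<bar>(quot_deriv x v - quot_deriv y v) $ i\<bar> \<le> (2 * R\<^sup>2 + 2 * R ^ 3) * norm (x - y) * norm v" for i
  proof -
    let ?u = "inverse (x $ first)" and ?w = "inverse (y $ first)"
    let ?n = "if i = lst then 0 else v $ nxt i"
    let ?c = "if i = lst then 1 else x $ nxt i" and ?d = "if i = lst then 1 else y $ nxt i"
    have cd: "\<bar>?c - ?d\<bar> \<le> norm (x - y)" "0 \<le> ?d" "?d \<le> 1"
      using c[of "nxt i"] y(1) by (auto simp: unit_cube_def)
    note b = inverse_diff_bound[OF x(2) y(2) x(3) y(3) c cd]
    have "(quot_deriv x v - quot_deriv y v) $ i = ?n * (?u - ?w) - (?c * ?u\<^sup>2 - ?d * ?w\<^sup>2) * v $ first"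
      using x y by (simp add: quot_deriv_alt algebra_simps)
    then have "\<bar>(quot_deriv x v - quot_deriv y v) $ i\<bar> \<le> \<bar>?n\<bar> * \<bar>?u - ?w\<bar> + \<bar>?c * ?u\<^sup>2 - ?d * ?w\<^sup>2\<bar> * \<bar>v $ first\<bar>"
      by (simp only: abs_mult[symmetric] abs_triangle_ineq4)
    also have "\<dots> \<le> norm v * (R\<^sup>2 * norm (x - y)) + ((R\<^sup>2 + 2 * R ^ 3) * norm (x - y)) * norm v"
    proof (intro add_mono mult_mono b)
      show "\<bar>?n\<bar> \<le> norm v" "\<bar>v $ first\<bar> \<le> norm v" using component_le_norm_cart[of v] by auto
      show "0 \<le> (R\<^sup>2 + 2 * R ^ 3) * norm (x - y)" using b(2) by linarith
    qed auto
    also have "\<dots> = (2 * R\<^sup>2 + 2 * R ^ 3) * norm (x - y) * norm v" by (simp add: algebra_simps)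
    finally show ?thesis .
  qed
  then have "(\<Sum>i\<in>UNIV. \<bar>(quot_deriv x v - quot_deriv y v) $ i\<bar>) \<le> (\<Sum>i\<in>(UNIV::'m set). (2 * R\<^sup>2 + 2 * R ^ 3) * norm (x - y) * norm v)"
    by (rule sum_mono)
  then show ?thesis using norm_le_l1_cart[of "quot_deriv x v - quot_deriv y v"] by (simp add: mult.assoc)
qed

lemma extends_C1_Lip_cell:
  assumes S: "S \<in> cells"
  shows "extends_C1_Lip T S"
proof -
  \<comment> \<open>On the cell, \<open>1 / x\<^sub>1\<close> is below its integer part plus one.\<close>
  define R where "R = real_of_int (cell_digits S lst) + 1"
  define G where "G x = Blinfun (quot_deriv x)" for x
  define L where "L = real CARD('m) * (2 * R\<^sup>2 + 2 * R ^ 3)"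
  have R: "1 \<le> R" using cell_props(1)[OF S] by (simp add: R_def admissible_digits_def)
  have "S \<subseteq> {x. inverse R \<le> x $ first}"
  proof
    fix x assume x: "x \<in> S"
    then have x1: "0 < x $ first" using cell_props(2)[OF S] by blast
    have "jp_quot e x $ lst < R" using cell_props(3)[OF S x] by (auto simp: R_def jp_digit_domain_def)
    then have "inverse (x $ first) < R" using x1 by (simp add: jp_quot_nth inverse_eq_divide)
    then have "inverse R \<le> x $ first" using x1 by (metis inverse_inverse_eq le_imp_inverse_le less_imp_le positive_imp_inverse_positive)
    then show "x \<in> {x. inverse R \<le> x $ first}" by simp
  qed
  moreover have "closed {x :: real ^ 'm. inverse R \<le> x $ first}"
    by (intro closed_Collect_le continuous_intros)
  ultimately have "closure S \<subseteq> {x. inverse R \<le> x $ first}" by (rule closure_minimal)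
  moreover have "closure S \<subseteq> unit_cube" using closure_mono[OF cell_props(2)[OF S]] closure_open_cube by blast
  ultimately have cl: "x \<in> unit_cube" "0 < x $ first" "inverse (x $ first) \<le> R" if "x \<in> closure S" for x
  proof -
    assume a: "closure S \<subseteq> {x. inverse R \<le> x $ first}" "closure S \<subseteq> unit_cube"
    show "x \<in> unit_cube" using a that by blast
    have p: "0 < inverse R" "inverse R \<le> x $ first" using a that R by auto
    then show "0 < x $ first" by linarith
    show "inverse (x $ first) \<le> R" using le_imp_inverse_le[OF p(2,1)] by simp
  qed
  have der: "(jp_quot e has_derivative quot_deriv x) (at x within closure S)" if "x \<in> closure S" for x
    using cl(2)[OF that] by (intro jp_quot_has_derivative) auto
  have G: "blinfun_apply (G x) = quot_deriv x" if "x \<in> closure S" for x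
    unfolding G_def by (rule bounded_linear_Blinfun_apply[OF has_derivative_bounded_linear[OF der[OF that]]])
  have "\<forall>x\<in>S. jp_quot e x - (\<chi> i. of_int (cell_digits S i)) = T x"
    by (simp add: jp_map_digit_domain(1)[OF cell_props(3)[OF S]] vec_eq_iff)
  moreover have "((\<lambda>x. jp_quot e x - (\<chi> i. of_int (cell_digits S i))) has_derivative blinfun_apply (G x)) (at x within closure S)"
    if "x \<in> closure S" for x
    unfolding G[OF that] using has_derivative_diff[OF der[OF that] has_derivative_const] by simp
  moreover have "L-lipschitz_on (closure S) G"
  proof (rule lipschitz_onI)
    show "0 \<le> L" using R by (simp add: L_def)
    fix x y assume xy: "x \<in> closure S" "y \<in> closure S"
    have "norm (G x - G y) \<le> L * norm (x - y)"
    proof (rule norm_blinfun_bound)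
      show "0 \<le> L * norm (x - y)" using R by (simp add: L_def)
      fix v
      show "norm (blinfun_apply (G x - G y) v) \<le> L * norm (x - y) * norm v"
        using quot_deriv_lipschitz[OF cl[OF xy(1)] cl[OF xy(2)]]
        by (simp add: blinfun.diff_left G xy L_def)
    qed
    then show "dist (G x) (G y) \<le> L * dist x y" by (simp add: dist_norm)
  qed
  ultimately show ?thesis unfolding extends_C1_Lip_def
    by (intro exI[of _ "\<lambda>x. jp_quot e x - (\<chi> i. of_int (cell_digits S i))"] exI[of _ G] exI[of _ L] conjI ballI) blast+
qed

lemma piecewise_system_jp: "piecewise_system unit_cube T cells"
  unfolding piecewise_system_def
proof (intro conjI ballI)
  show "compact (unit_cube :: (real ^ 'm) set)" "connected (unit_cube :: (real ^ 'm) set)"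
    by (simp_all add: unit_cube_eq_cbox compact_cbox convex_connected)
qed (use T_unit_cube countable_cells cells_partition inj_on_cell extends_C1_Lip_cell in auto)

section \<open>Cylinders and admissible inverse branches\<close>

lemma cylinder_word_branch:
  assumes "set w \<subseteq> cells" "x \<in> cylinder T w"
  shows "inverse_branch T w ((T ^^ length w) x) = x \<and> word_branch (map cell_digits w) ((T ^^ length w) x) = x"
  using assms
proof (induction w arbitrary: x)
  case (Cons S w)
  have S: "S \<in> cells" "x \<in> S" using Cons.prems by auto
  have *: "(T ^^ length (S # w)) x = (T ^^ length w) (T x)" by (simp add: funpow_swap1)
  show ?case unfolding * using Cons.IH[of "T x"] Cons.prems S
    the_inv_into_f_f[OF inj_on_cell[OF S(1)] S(2)] cell_props(5)[OF S] by simp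
qed auto

lemma funpow_in_open_cube:
  assumes "set w \<subseteq> cells" "x \<in> cylinder T w" "w \<noteq> []"
  shows "(T ^^ length w) x \<in> open_cube"
  using assms
proof (induction w arbitrary: x)
  case (Cons S w)
  have *: "(T ^^ length (S # w)) x = (T ^^ length w) (T x)" by (simp add: funpow_swap1)
  show ?case
  proof (cases "w = []")
    case True
    then show ?thesis using Cons.prems cell_props(4)[of S x] by simp
  next
    case False
    then show ?thesis unfolding * using Cons by auto
  qed
qed auto

lemma all_admissible_cell_digits: "set w \<subseteq> cells \<Longrightarrow> all_admissible (map cell_digits w)"
  using cell_props(1) by auto

text \<open>
  On a cell the algorithm is \<open>jp_quot e x - a\<close>, which undoes the branch because denominators of
  branches are at least 1 at vectors with nonnegative coordinates.
\<close>

lemma funpow_word_branch: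
  assumes "set w \<subseteq> cells" "y \<in> open_cube" "word_branch (map cell_digits w) y \<in> cylinder T w"
  shows "(T ^^ length w) (word_branch (map cell_digits w) y) = y"
  using assms
proof (induction w)
  case (Cons S w)
  let ?z = "word_branch (map cell_digits w) y"
  have S: "S \<in> cells" and b: "branch (cell_digits S) ?z \<in> S" "T (branch (cell_digits S) ?z) \<in> cylinder T w"
    using Cons.prems by auto
  have "0 \<le> ?z $ i" for i using Cons.prems by (intro word_branch_nonneg all_admissible_cell_digits) (auto simp: less_imp_le)
  then have "1 \<le> denom (cell_digits S) ?z" using cell_props(1)[OF S] by (intro denom_ge_1)
  then have "jp_quot e (branch (cell_digits S) ?z) $ i = ?z $ i + of_int (cell_digits S i)" for i
    by (intro quot_branch) auto
  then have T: "T (branch (cell_digits S) ?z) = ?z"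
    using jp_map_digit_domain(1)[OF cell_props(3)[OF S b(1)]] by (simp add: vec_eq_iff)
  then have "(T ^^ length w) ?z = y" using Cons b by auto
  then show ?case using T by (simp add: funpow_swap1)
qed simp

text \<open>
  Exhibits the domain as the preimage of an open set under a continuous map, which is how it is
  seen to be open.
\<close>

lemma branch_dom_eq:
  assumes "set w \<subseteq> cells" "w \<noteq> []"
  shows "branch_dom T w = {y \<in> open_cube. word_branch (map cell_digits w) y \<in> cylinder T w}"
proof (intro equalityI subsetI)
  fix y assume "y \<in> branch_dom T w"
  then show "y \<in> {y \<in> open_cube. word_branch (map cell_digits w) y \<in> cylinder T w}"
    using cylinder_word_branch[OF assms(1)] funpow_in_open_cube[OF assms(1) _ assms(2)] by (auto simp: branch_dom_def)
next
  fix y assume "y \<in> {y \<in> open_cube. word_branch (map cell_digits w) y \<in> cylinder T w}"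
  then show "y \<in> branch_dom T w"
    using funpow_word_branch[OF assms(1), of y] unfolding branch_dom_def by (metis (mono_tags, lifting) imageI mem_Collect_eq)
qed

lemma inverse_branch_eq:
  assumes "set w \<subseteq> cells" "y \<in> branch_dom T w"
  shows "inverse_branch T w y = word_branch (map cell_digits w) y"
  using assms cylinder_word_branch by (auto simp: branch_dom_def)

lemma open_cylinder_hit:
  assumes "set w \<subseteq> cells" "open V"
  shows "open {x \<in> cylinder T w. (T ^^ length w) x \<in> V}"
  using assms(1)
proof (induction w)
  case Nil then show ?case using assms by simp
next
  case (Cons S w)
  have "open (S \<inter> T -` {x \<in> cylinder T w. (T ^^ length w) x \<in> V})"
    using Cons by (intro continuous_open_preimage) (auto intro: continuous_on_cell open_cell)
  also have "S \<inter> T -` {x \<in> cylinder T w. (T ^^ length w) x \<in> V} = {x \<in> cylinder T (S # w). (T ^^ length (S # w)) x \<in> V}"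
    by (auto simp: funpow_swap1)
  finally show ?case .
qed

lemma open_cylinder: "set w \<subseteq> cells \<Longrightarrow> open (cylinder T w)"
  using open_cylinder_hit[of w UNIV] by simp

lemma open_branch_dom:
  assumes "set w \<subseteq> cells" "w \<noteq> []"
  shows "open (branch_dom T w)"
proof -
  have "open (open_cube \<inter> word_branch (map cell_digits w) -` cylinder T w)"
    by (intro continuous_open_preimage open_open_cube open_cylinder assms 
      continuous_on_subset[OF continuous_on_word_branch[OF all_admissible_cell_digits[OF assms(1)]]]) (auto simp: less_imp_le)
  also have "open_cube \<inter> word_branch (map cell_digits w) -` cylinder T w = branch_dom T w"
    unfolding branch_dom_eq[OF assms] by auto
  finally show ?thesis .
qed

lemma admissibleD:
  assumes "w \<in> admissible_words T cells n" "1 \<le> n"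
  shows "set w \<subseteq> cells" "w \<noteq> []" "length w = n" "all_admissible (map cell_digits w)"
  using assms all_admissible_cell_digits by (auto simp: admissible_words_def)

lemma branch_dom_open_cube:
  assumes "set w \<subseteq> cells" "w \<noteq> []" shows "branch_dom T w \<subseteq> open_cube"
  unfolding branch_dom_eq[OF assms] by blast

lemma uniformly_contracting_jp: "uniformly_contracting T cells"
proof -
  obtain \<rho> C where rC: "0 < \<rho>" "\<rho> < 1" "0 < C" and *:
    "\<And>ds x y. all_admissible ds \<Longrightarrow> x \<in> unit_cube \<Longrightarrow> y \<in> unit_cube \<Longrightarrow>
       norm (word_branch ds x - word_branch ds y) \<le> C * \<rho> ^ length ds * norm (x - y)"
    using word_branch_contraction by blast
  have "norm (inverse_branch T w x - inverse_branch T w y) \<le> C * \<rho> ^ n * norm (x - y)"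
    if "1 \<le> n" "w \<in> admissible_words T cells n" "x \<in> branch_dom T w" "y \<in> branch_dom T w" for n w x y
  proof -
    note w = admissibleD[OF that(2,1)]
    have "x \<in> unit_cube" "y \<in> unit_cube" using branch_dom_open_cube[OF w(1,2)] open_cube_subset that(3,4) by blast+
    then have "norm (word_branch (map cell_digits w) x - word_branch (map cell_digits w) y) \<le> C * \<rho> ^ length (map cell_digits w) * norm (x - y)"
      using * w(4) by blast
    then show ?thesis using that(3,4) by (simp add: inverse_branch_eq[OF w(1)] w(3))
  qed
  then show ?thesis unfolding uniformly_contracting_def using rC by blast
qed

text \<open>
  The inverse branch agrees with the projective map on an open set, so both have the same
  derivative there.
\<close>

lemma abs_jacobian_inverse_branch:
  assumes "set w \<subseteq> cells" "w \<noteq> []" "y \<in> branch_dom T w"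
  shows "abs_jacobian (inverse_branch T w) y = 1 / word_denom (map cell_digits w) y ^ (CARD('m) + 1)"
proof -
  have y: "0 \<le> y $ i" for i using branch_dom_open_cube[OF assms(1,2)] assms(3) by (auto simp: less_imp_le)
  obtain D where D: "(word_branch (map cell_digits w) has_derivative D) (at y)" 
    "\<bar>det (matrix D)\<bar> = 1 / word_denom (map cell_digits w) y ^ (CARD('m) + 1)"
    using word_branch_has_derivative[OF all_admissible_cell_digits[OF assms(1)] y] by blast
  have "(inverse_branch T w has_derivative D) (at y)"
    by (rule has_derivative_transform_within_open[OF D(1) open_branch_dom[OF assms(1,2)] assms(3)])
      (simp add: inverse_branch_eq[OF assms(1)])
  then have "frechet_derivative (inverse_branch T w) (at y) = D" by (rule frechet_derivative_at[symmetric])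
  then show ?thesis by (simp only: abs_jacobian_def D(2))
qed

lemma bounded_distortion_jp: "bounded_distortion T cells"
proof -
  obtain M where M: "0 < M" and *: "\<And>ds x y. all_admissible ds \<Longrightarrow> x \<in> unit_cube \<Longrightarrow> y \<in> unit_cube \<Longrightarrow>
       \<bar>(word_denom ds y / word_denom ds x) ^ (CARD('m) + 1) - 1\<bar> \<le> M * norm (x - y)"
    using word_denom_distortion by blast
  have "\<bar>abs_jacobian (inverse_branch T w) x / abs_jacobian (inverse_branch T w) y - 1\<bar> \<le> M * norm (x - y)"
    if "1 \<le> n" "w \<in> admissible_words T cells n" "x \<in> branch_dom T w" "y \<in> branch_dom T w" for n w x y
  proof -
    note w = admissibleD[OF that(2,1)]
    have "abs_jacobian (inverse_branch T w) x / abs_jacobian (inverse_branch T w) y = 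
      (word_denom (map cell_digits w) y / word_denom (map cell_digits w) x) ^ (CARD('m) + 1)"
      unfolding abs_jacobian_inverse_branch[OF w(1,2) that(3)] abs_jacobian_inverse_branch[OF w(1,2) that(4)]
      by (simp add: power_divide)
    moreover have "x \<in> unit_cube" "y \<in> unit_cube"
      using branch_dom_open_cube[OF w(1,2)] open_cube_subset that(3,4) by blast+
    ultimately show ?thesis using * w(4) by presburger
  qed
  then show ?thesis unfolding bounded_distortion_def using M by blast
qed

end

context jacobi_perron begin

section \<open>Topological transitivity\<close>

lemma cylinder_append:
  "x \<in> cylinder T (w @ v) \<longleftrightarrow> x \<in> cylinder T w \<and> (T ^^ length w) x \<in> cylinder T v"
  by (induction w arbitrary: x) (auto simp: funpow_swap1)

text \<open>
  By induction on the depth: cells are dense, and their images are open, so they meet the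
  cylinders of smaller depth.
\<close>

lemma dense_cylinders:
  assumes "open U" "U \<inter> open_cube \<noteq> {}"
  shows "\<exists>w. set w \<subseteq> cells \<and> length w = n \<and> U \<inter> cylinder T w \<inter> open_cube \<noteq> {}"
  using assms
proof (induction n arbitrary: U)
  case 0
  then show ?case by (intro exI[of _ "[]"]) auto
next
  case (Suc n)
  obtain S where S: "S \<in> cells" "U \<inter> S \<noteq> {}" using dense_cells[OF Suc.prems] .
  have "open (T ` (U \<inter> S))" by (intro open_image_cell S Suc.prems)
  moreover have "T ` (U \<inter> S) \<inter> open_cube \<noteq> {}" using S(2) cell_props(4)[OF S(1)] by blast
  ultimately obtain w where w: "set w \<subseteq> cells" "length w = n" "T ` (U \<inter> S) \<inter> cylinder T w \<inter> open_cube \<noteq> {}"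
    using Suc.IH by blast
  then obtain x where x: "x \<in> U" "x \<in> S" "T x \<in> cylinder T w" by blast
  then have "x \<in> U \<inter> cylinder T (S # w) \<inter> open_cube" using cell_props(2)[OF S(1)] by auto
  then show ?case using S(1) w by (intro exI[of _ "S # w"]) auto
qed

text \<open>
  The Markov property for words. Going backwards along the word, the intermediate images of the
  two points lie in a common cell, hence in the chamber of that cell, and then the preceding
  branch maps both into its cell.
\<close>

lemma word_branch_in_cylinder:
  assumes "set w \<subseteq> cells" "w \<noteq> []" "x \<in> cylinder T w" "(T ^^ length w) x \<in> order_chamber q" "y \<in> order_chamber q"
  shows "word_branch (map cell_digits w) y \<in> cylinder T w"
  using assms
proof (induction w arbitrary: x)
  case (Cons S w)
  have S: "S \<in> cells" "x \<in> S" "T x \<in> cylinder T w" "set w \<subseteq> cells" using Cons.prems by auto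
  let ?z = "word_branch (map cell_digits w) y"
  have Tn: "(T ^^ length w) (T x) \<in> order_chamber q" using Cons.prems(4) by (simp add: funpow_swap1)
  \<comment> \<open>Both \<open>T x\<close> and \<open>?z\<close> lie in the chamber of the next cell of the word, or in the given chamber if the word ends.\<close>
  obtain q' where q': "T x \<in> order_chamber q'" "?z \<in> order_chamber q'" "?z \<in> cylinder T w"
  proof (cases "w = []")
    case True
    then show thesis using that[of q] Tn Cons.prems(5) by simp
  next
    case False
    then have z: "?z \<in> cylinder T w" using Cons.IH[OF S(4) _ S(3) Tn Cons.prems(5)] by blast
    from False obtain S' w' where w: "w = S' # w'" by (cases w) auto
    then have S': "S' \<in> cells" "T x \<in> S'" "?z \<in> S'" using S z by auto
    obtain r where "S' = digit_domain (cell_digits S') \<inter> order_chamber r" using cellE[OF S'(1)] .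
    then show thesis using that[of r] S' z by blast
  qed
  have "order_chamber q' \<subseteq> T ` S" by (rule chamber_subset_image[OF S(1)]) (use S(2) q'(1) in blast)
  then have "?z \<in> T ` S" using q'(2) by blast
  then obtain s where s: "s \<in> S" "?z = T s" by blast
  then have "branch (cell_digits S) ?z = s" using cell_props(5)[OF S(1)] by simp
  then show ?case using s q'(3) by simp
qed simp

text \<open>
  Reachability of \<open>V\<close> is treated as a property of a whole chamber rather than of a point, since
  only the order of the coordinates matters for the next step.
\<close>

definition reaches :: "(real ^ 'm) set \<Rightarrow> ('m \<times> 'm) set \<Rightarrow> bool" where
  "reaches V q \<longleftrightarrow> (\<exists>v p. set v \<subseteq> cells \<and> p \<in> order_chamber q \<and> p \<in> cylinder T v \<and> (T ^^ length v) p \<in> V)"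

lemma reaches_step:
  assumes "S \<in> cells" "S \<subseteq> order_chamber q" "order_chamber q' \<subseteq> T ` S" "reaches V q'"
  shows "reaches V q"
proof -
  obtain v p where v: "set v \<subseteq> cells" "p \<in> order_chamber q'" "p \<in> cylinder T v" "(T ^^ length v) p \<in> V"
    using assms(4) by (auto simp: reaches_def)
  then obtain s where s: "s \<in> S" "T s = p" using assms(3) by blast
  then have "s \<in> cylinder T (S # v)" "(T ^^ length (S # v)) s \<in> V" using v by (auto simp: funpow_swap1)
  then show ?thesis unfolding reaches_def using v assms s by (intro exI[of _ "S # v"] exI[of _ s]) auto
qed

lemma cell_through:
  assumes "admissible_digits a" "y \<in> order_chamber q'" "branch a y \<in> order_chamber q"
  obtains S where "S \<in> cells" "S \<subseteq> order_chamber q" "order_chamber q' \<subseteq> T ` S"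
proof -
  let ?S = "digit_domain a \<inter> order_chamber q"
  have oc: "y \<in> open_cube" "branch a y \<in> open_cube" using assms chamber_open_cube by blast+
  have "branch a y \<in> digit_domain a" "T (branch a y) = y" using branch_in_digit_domain[OF assms(1) oc] .
  then have S: "?S \<in> cells" using assms(3) cellI by blast
  moreover have "order_chamber q' \<subseteq> T ` ?S"
  proof (rule chamber_subset_image[OF S])
    have "y \<in> T ` ?S" unfolding image_cell[OF assms(1)] using oc assms by blast
    then show "T ` ?S \<inter> order_chamber q' \<noteq> {}" using assms by blast
  qed
  ultimately show thesis using that by blast
qed

definition shift :: "real ^ 'm \<Rightarrow> real \<Rightarrow> real ^ 'm" where
  "shift x t = (\<chi> i. if i = lst then t else x $ nxt i)"

text \<open>
  The digits \<open>a\<^sub>k\<^sub>-\<^sub>1 = 1\<close> if \<open>x\<^sub>k > x\<^sub>1\<close> and \<open>0\<close> otherwise, with last digit 2, recreate the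
  position of \<open>x\<^sub>1\<close> among the other coordinates; among coordinates with the same digit the order
  is inherited. So the branch with these digits maps \<open>(x\<^sub>2, \<dots>, x\<^sub>m, t)\<close> back into the chamber of
  \<open>x\<close>.
\<close>

lemma reaches_shift:
  assumes x: "x \<in> order_chamber q" and t: "t < 1" "\<And>i. x $ i < t" and y: "shift x t \<in> order_chamber q'"
    and "reaches V q'"
  shows "reaches V q"
proof -
  \<comment> \<open>Digit 0 is below and digit 1 above the numerator 1; the last digit 2 keeps the image below 1.\<close>
  define a :: "'m \<Rightarrow> int" where "a i = (if i = lst then 2 else if x $ first < x $ nxt i then 1 else 0)" for i
  have d: "admissible_digits a" by (auto simp: admissible_digits_def a_def)
  have oc: "x \<in> open_cube" "shift x t \<in> open_cube" using x y chamber_open_cube by blast+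
  have inj: "x $ i = x $ j \<longleftrightarrow> i = j" for i j using x by (auto simp: order_chamber_def inj_def)
  have "branch a (shift x t) $ nxt i < branch a (shift x t) $ nxt j \<longleftrightarrow> x $ nxt i < x $ nxt j" for i j
  proof -
    have neq: "i \<noteq> lst \<Longrightarrow> x $ nxt i \<noteq> x $ first" for i by (simp add: inj)
    show ?thesis
      unfolding branch_order[OF d oc(2)] numer_less_numer[OF oc(2)]
      using neq[of i] neq[of j] by (cases "i = lst"; cases "j = lst") (auto simp: a_def shift_def)
  qed
  then have ord: "branch a (shift x t) $ i < branch a (shift x t) $ j \<longleftrightarrow> x $ i < x $ j" for i j
    by (metis nxt_prv)
  have "branch a (shift x t) \<in> open_cube"
    unfolding branch_in_open_cube[OF d oc(2)] numer_less_denom[OF oc(2)] by (auto simp: a_def)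
  then have "branch a (shift x t) \<in> order_chamber q"
    using order_chamber_mono[OF x] ord by blast
  then obtain S where "S \<in> cells" "S \<subseteq> order_chamber q" "order_chamber q' \<subseteq> T ` S"
    using cell_through[OF d y] by blast
  then show ?thesis using reaches_step assms by blast
qed

text \<open>
  Strictly increasing digits make the order of the coordinates of the image independent of the
  argument. The free last digit \<open>N\<close> gives a family of branches defined on the whole open cube
  whose fixed points have different Jacobians.
\<close>

definition ramp :: "nat \<Rightarrow> 'm \<Rightarrow> int" where
  "ramp N i = (if i = lst then int N else int (pos i))"

lemma ramp_digits: 
  assumes "CARD('m) \<le> N" 
  shows "admissible_digits (ramp N)"
  using assms card_ge_2 pos_le_card by (auto simp: admissible_digits_def ramp_def intro: order_trans)

lemma ramp_branch:
  assumes N: "CARD('m) \<le> N" and y: "y \<in> open_cube"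
  shows "branch (ramp N) y \<in> open_cube" "pos i < pos j \<Longrightarrow> branch (ramp N) y $ i < branch (ramp N) y $ j"
proof -
  have plt: "pos i < CARD('m)" if "i \<noteq> lst" for i
    using that pos_le_card[of i] pos_inject[of i lst] by (auto simp: le_less)
  show "branch (ramp N) y \<in> open_cube"
    unfolding branch_in_open_cube[OF ramp_digits[OF N] y] numer_less_denom[OF y]
    using plt N card_ge_2 by (force simp: ramp_def)
  assume ij: "pos i < pos j"
  obtain i' j' where i': "i = nxt i'" "j = nxt j'" by (metis nxt_prv)
  have "numer (ramp N) y i' < numer (ramp N) y j'"
    unfolding numer_less_numer[OF y] using ij pos_ge_1[of j'] by (auto simp: i' pos_nxt_eq ramp_def split: if_splits)
  then show "branch (ramp N) y $ i < branch (ramp N) y $ j"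
    unfolding i' branch_order[OF ramp_digits[OF N] y] .
qed

text \<open>
  The condition compares each of the last \<open>k\<close> coordinates with all coordinates before it, so the
  case \<open>k = m\<close> says that the vector is increasing.
\<close>

definition tail_ascending :: "nat \<Rightarrow> real ^ 'm \<Rightarrow> bool" where
  "tail_ascending k x \<longleftrightarrow> (\<forall>i j. pos i < pos j \<and> CARD('m) < pos j + k \<longrightarrow> x $ i < x $ j)"

text \<open>
  The cell with digits \<open>a\<^sub>i = i\<close> lies in the chamber of increasing vectors and is mapped onto the
  open cube.
\<close>

lemma reaches_ascending:
  assumes "x \<in> order_chamber q" "tail_ascending CARD('m) x" "open V" "V \<inter> open_cube \<noteq> {}"
  shows "reaches V q"
proof -
  obtain y q' where y: "y \<in> V" "y \<in> order_chamber q'" using dense_chambers[OF assms(3,4)] .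
  have oc: "y \<in> open_cube" using y chamber_open_cube by blast
  have x: "x $ i < x $ j \<longleftrightarrow> pos i < pos j" for i j
  proof -
    have *: "x $ i < x $ j" if "pos i < pos j" for i j
      using assms(2) that unfolding tail_ascending_def by auto
    show ?thesis using *[of i j] *[of j i] pos_inject[of i j] by (cases "pos i" "pos j" rule: linorder_cases) auto
  qed
  have b: "branch (ramp CARD('m)) y $ i < branch (ramp CARD('m)) y $ j \<longleftrightarrow> pos i < pos j" for i j
    using ramp_branch(2)[OF order_refl oc, of i j] ramp_branch(2)[OF order_refl oc, of j i] pos_inject[of i j] 
    by (cases "pos i" "pos j" rule: linorder_cases) auto
  have "branch (ramp CARD('m)) y \<in> order_chamber q"
    by (rule order_chamber_mono[OF assms(1) ramp_branch(1)[OF order_refl oc]]) (simp add: x b)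
  then obtain S where S: "S \<in> cells" "S \<subseteq> order_chamber q" "order_chamber q' \<subseteq> T ` S"
    using cell_through[OF ramp_digits[OF order_refl] y(2)] by blast
  have "reaches V q'" unfolding reaches_def using y by (intro exI[of _ "[]"] exI[of _ y]) auto
  then show ?thesis using reaches_step[OF S] by blast
qed

text \<open>
  Downward induction on \<open>k\<close>: appending a coordinate larger than all others lengthens the
  increasing tail by one.
\<close>

lemma reaches_tail_ascending:
  assumes "k \<le> CARD('m)" "x \<in> order_chamber q" "tail_ascending k x" "open V" "V \<inter> open_cube \<noteq> {}"
  shows "reaches V q"
  using assms(1-3)
proof (induction k arbitrary: x q rule: inc_induct)
  case base
  then show ?case using reaches_ascending assms(4,5) by blast
next
  case (step k)
  define M where "M = Max (range (\<lambda>i. x $ i))"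
  \<comment> \<open>The new last coordinate has to lie strictly between the largest coordinate and 1.\<close>
  define t where "t = (M + 1) / 2"
  have x: "0 < x $ i" "x $ i < 1" for i using chamber_open_cube[OF step.prems(1)] by auto
  have "M \<in> range (\<lambda>i. x $ i)" unfolding M_def by (rule Max_in) auto
  then have M: "M < 1" "0 < M" using x by auto
  have le: "x $ i \<le> M" for i unfolding M_def by (rule Max_ge) auto
  have t: "t < 1" "x $ i < t" "0 < t" for i using M le[of i] by (simp_all add: t_def)
  have inj: "inj (\<lambda>i. x $ i)" using step.prems(1) by (simp add: order_chamber_def)
  have "inj (\<lambda>i. shift x t $ i)"
  proof (rule injI)
    fix i j assume "shift x t $ i = shift x t $ j"
    moreover have "x $ nxt i = x $ nxt j \<Longrightarrow> nxt i = nxt j" by (rule injD[OF inj])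
    ultimately show "i = j" using t(2)[of "nxt i"] t(2)[of "nxt j"]
      by (cases "i = lst"; cases "j = lst") (simp_all add: shift_def)
  qed
  moreover have "shift x t \<in> open_cube" using x t by (auto simp: shift_def)
  ultimately obtain q' where y: "shift x t \<in> order_chamber q'" using in_own_chamber by blast
  have "tail_ascending (Suc k) (shift x t)" unfolding tail_ascending_def
  proof (intro allI impI)
    fix i j assume ij: "pos i < pos j \<and> CARD('m) < pos j + Suc k"
    then have i: "i \<noteq> lst" using pos_le_card[of j] by auto
    show "shift x t $ i < shift x t $ j"
    proof (cases "j = lst")
      case True
      then show ?thesis using i t by (simp add: shift_def)
    next
      case False
      then have "x $ nxt i < x $ nxt j" using step.prems(2) ij i unfolding tail_ascending_def by (simp add: pos_nxt)
      then show ?thesis using i False by (simp add: shift_def)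
    qed
  qed
  then have "reaches V q'" using step.IH y by blast
  then show ?case using reaches_shift[OF step.prems(1) t(1,2) y] by blast
qed

lemma reaches_all:
  assumes "order_chamber q \<noteq> ({} :: (real ^ 'm) set)" "open V" "V \<inter> open_cube \<noteq> {}"
  shows "reaches V q"
proof -
  obtain x :: "real ^ 'm" where x: "x \<in> order_chamber q" using assms by blast
  have "tail_ascending 0 x" using pos_le_card unfolding tail_ascending_def by (metis add_0_right not_le)
  then show ?thesis using reaches_tail_ascending[OF _ x _ assms(2,3), of 0] by simp
qed

definition hits :: "(real ^ 'm) set \<Rightarrow> (real ^ 'm) set" where
  "hits V = (\<Union>w\<in>lists cells. {x \<in> cylinder T w. (T ^^ length w) x \<in> V})"

lemma open_hits: "open V \<Longrightarrow> open (hits V)"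
  unfolding hits_def by (intro open_UN ballI open_cylinder_hit) auto

text \<open>
  A small cylinder inside \<open>U\<close> has an image containing a chamber, from which \<open>V\<close> is reached; the
  resulting word is prefixed by the word of the cylinder.
\<close>

lemma hits_dense:
  assumes U: "open U" "U \<inter> open_cube \<noteq> {}" and V: "open V" "V \<inter> open_cube \<noteq> {}"
  shows "U \<inter> open_cube \<inter> hits V \<noteq> {}"
proof -
  obtain \<rho> C where rC: "0 < \<rho>" "\<rho> < 1" "0 < C" and *:
    "\<And>ds x y. all_admissible ds \<Longrightarrow> x \<in> unit_cube \<Longrightarrow> y \<in> unit_cube \<Longrightarrow>
       norm (word_branch ds x - word_branch ds y) \<le> C * \<rho> ^ length ds * norm (x - y)"
    using word_branch_contraction by blast
  obtain z where z: "z \<in> U \<inter> open_cube" using U by blast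
  obtain \<epsilon> where \<epsilon>: "0 < \<epsilon>" "ball z \<epsilon> \<subseteq> U \<inter> open_cube" 
    using open_contains_ball[of "U \<inter> open_cube"] open_Int[OF U(1) open_open_cube] z by blast
  define B where "B = diameter (unit_cube :: (real ^ 'm) set)"
  have B: "norm (x - y) \<le> B" if "x \<in> unit_cube" "y \<in> unit_cube" for x y :: "real ^ 'm"
    using diameter_bounded_bound[OF _ that] by (simp add: B_def unit_cube_eq_cbox dist_norm)
  have "(\<lambda>n. C * \<rho> ^ n * B) \<longlonglongrightarrow> C * 0 * B"
    using rC by (intro tendsto_intros LIMSEQ_realpow_zero) auto
  then have "eventually (\<lambda>n. C * \<rho> ^ n * B < \<epsilon> / 2) sequentially"
    using \<epsilon> by (intro order_tendstoD) auto
  then have "eventually (\<lambda>n. C * \<rho> ^ n * B < \<epsilon> / 2 \<and> 1 \<le> n) sequentially"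
    by (intro eventually_conj eventually_ge_at_top)
  then obtain n where n: "C * \<rho> ^ n * B < \<epsilon> / 2" "1 \<le> n"
    using eventually_happens sequentially_bot by blast
  obtain w where w: "set w \<subseteq> cells" "length w = n" "ball z (\<epsilon> / 2) \<inter> cylinder T w \<inter> open_cube \<noteq> {}"
  proof -
    have "z \<in> ball z (\<epsilon> / 2) \<inter> open_cube" using \<epsilon> z by simp
    then have "ball z (\<epsilon> / 2) \<inter> open_cube \<noteq> {}" by blast
    from dense_cylinders[OF open_ball this, of n] that show thesis by blast
  qed
  have w0: "w \<noteq> []" using w n by auto
  obtain x0 where x0: "x0 \<in> ball z (\<epsilon> / 2)" "x0 \<in> cylinder T w" using w by blast
  then have "(T ^^ length w) x0 \<in> branch_dom T w" by (auto simp: branch_dom_def)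
  then have "branch_dom T w \<inter> open_cube \<noteq> {}" using branch_dom_open_cube[OF w(1) w0] by blast
  then obtain y q where y: "y \<in> branch_dom T w" "y \<in> order_chamber q"
    using dense_chambers[OF open_branch_dom[OF w(1) w0]] by blast
  have "reaches V q" using reaches_all V y by blast
  then obtain v p where v: "set v \<subseteq> cells" "p \<in> order_chamber q" "p \<in> cylinder T v" "(T ^^ length v) p \<in> V"
    by (auto simp: reaches_def)
  let ?x = "word_branch (map cell_digits w) p"
  obtain x1 where x1: "x1 \<in> cylinder T w" "(T ^^ length w) x1 = y" using y by (auto simp: branch_dom_def)
  have xc: "?x \<in> cylinder T w" using word_branch_in_cylinder[OF w(1) w0 x1(1)] x1 y v by simp
  have p: "p \<in> open_cube" using v chamber_open_cube by blast
  have Tx: "(T ^^ length w) ?x = p" by (rule funpow_word_branch[OF w(1) p xc])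
  have x0': "x0 = word_branch (map cell_digits w) ((T ^^ length w) x0)" using cylinder_word_branch[OF w(1) x0(2)] by simp
  have x0o: "(T ^^ length w) x0 \<in> unit_cube" using funpow_in_open_cube[OF w(1) x0(2) w0] open_cube_subset by blast
  have pu: "p \<in> unit_cube" using p open_cube_subset by blast
  have "norm (?x - word_branch (map cell_digits w) ((T ^^ length w) x0)) \<le> C * \<rho> ^ n * norm (p - (T ^^ length w) x0)"
    using *[OF all_admissible_cell_digits[OF w(1)] pu x0o] w(2) by simp
  also have "\<dots> \<le> C * \<rho> ^ n * B" using rC B[OF pu x0o] by (intro mult_left_mono) auto
  finally have "dist ?x x0 < \<epsilon> / 2" using n x0' by (simp add: dist_norm)
  moreover have "dist z x0 < \<epsilon> / 2" using x0 by simp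
  ultimately have "dist z ?x < \<epsilon>" using dist_triangle_half_l by blast
  then have "?x \<in> U \<inter> open_cube" using \<epsilon> by auto
  moreover have "?x \<in> hits V" unfolding hits_def
  proof (rule UN_I[of "w @ v"])
    show "?x \<in> {x \<in> cylinder T (w @ v). (T ^^ length (w @ v)) x \<in> V}"
      using xc Tx v by (simp add: cylinder_append funpow_add add.commute[of "length w"])
  qed (use w v in auto)
  ultimately show ?thesis by blast
qed

text \<open>
  Baire category: a point in all the sets \<open>hits V\<close>, for \<open>V\<close> in a countable basis, has a dense
  orbit.
\<close>

lemma topologically_transitive_jp: "topologically_transitive unit_cube T"
proof -
  obtain \<B> :: "(real ^ 'm) set set" where B: "countable \<B>" "topological_basis \<B>"
    using ex_countable_basis by blast
  define \<G> where "\<G> = (\<lambda>V. unit_cube \<inter> hits V) ` {V \<in> \<B>. V \<inter> open_cube \<noteq> {}}"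
  have "(unit_cube :: (real ^ 'm) set) \<subseteq> closure (\<Inter>\<G>)"
  proof (rule Baire)
    show "closed (unit_cube :: (real ^ 'm) set)" by (simp add: unit_cube_eq_cbox closed_cbox)
    show "countable \<G>" unfolding \<G>_def using B by (intro countable_image) (auto intro: countable_subset)
    fix G assume "G \<in> \<G>"
    then obtain V where V: "V \<in> \<B>" "V \<inter> open_cube \<noteq> {}" and G: "G = unit_cube \<inter> hits V" by (auto simp: \<G>_def)
    have oV: "open V" using B V topological_basis_open by blast
    have "openin (top_of_set unit_cube) G" unfolding G using open_hits[OF oV] by (rule openin_open_Int)
    moreover have "open_cube \<subseteq> closure G"
    proof
      fix z assume z: "z \<in> open_cube"
      show "z \<in> closure G" unfolding closure_iff_nhds_not_empty
      proof (intro allI impI)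
        fix A U assume U: "U \<subseteq> A" "open U" "z \<in> U"
        then have "U \<inter> open_cube \<inter> hits V \<noteq> {}" using z by (intro hits_dense oV V) auto
        then show "G \<inter> A \<noteq> {}" using U open_cube_subset by (auto simp: G)
      qed
    qed
    then have "unit_cube \<subseteq> closure G" using closure_minimal[of open_cube "closure G"] closure_open_cube by simp
    ultimately show "openin (top_of_set unit_cube) G \<and> unit_cube \<subseteq> closure G" by blast
  qed
  moreover have "(unit_cube :: (real ^ 'm) set) \<noteq> {}" by (auto simp: unit_cube_def intro!: exI[of _ 0])
  ultimately have "\<Inter>\<G> \<noteq> {}" by auto
  then obtain x where x: "x \<in> \<Inter>\<G>" by blast
  have meets: "\<exists>n. (T ^^ n) x \<in> U" "x \<in> unit_cube" if U: "open U" "U \<inter> unit_cube \<noteq> {}" for U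
  proof -
    have "U \<inter> closure open_cube \<noteq> {}" using U closure_open_cube by simp
    then obtain z where z: "z \<in> U" "z \<in> open_cube" using open_Int_closure_eq_empty[OF U(1)] by blast
    obtain V where V: "V \<in> \<B>" "z \<in> V" "V \<subseteq> U" using topological_basisE[OF B(2) U(1) z(1)] .
    then have "unit_cube \<inter> hits V \<in> \<G>" using z by (auto simp: \<G>_def)
    then have "x \<in> unit_cube \<inter> hits V" using x by blast
    then show "\<exists>n. (T ^^ n) x \<in> U" "x \<in> unit_cube" using V(3) by (auto simp: hits_def)
  qed
  have "x \<in> unit_cube" by (rule meets(2)[of UNIV]) (auto simp: unit_cube_def intro!: exI[of _ 0])
  moreover have "unit_cube \<subseteq> closure (range (\<lambda>n. (T ^^ n) x))"
  proof
    fix z :: "real ^ 'm" assume z: "z \<in> unit_cube"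
    show "z \<in> closure (range (\<lambda>n. (T ^^ n) x))" unfolding closure_iff_nhds_not_empty
    proof (intro allI impI)
      fix A U assume U: "U \<subseteq> A" "open U" "z \<in> U"
      then obtain n where "(T ^^ n) x \<in> U" using meets(1)[of U] z by blast
      then show "range (\<lambda>n. (T ^^ n) x) \<inter> A \<noteq> {}" using U by blast
    qed
  qed
  ultimately show ?thesis unfolding topologically_transitive_def by blast
qed

end

section \<open>Non-arithmeticity\<close>

text \<open>
  Two distinct points of a lattice \<open>c \<int>\<close> have distance at least \<open>\<bar>c\<bar>\<close>, while consecutive values
  differ by at most \<open>k ln (1 + 2 / N) \<le> 2 k / N\<close>. The case \<open>c = 0\<close> is excluded because the
  logarithms are positive.
\<close>

lemma log_spacing_not_lattice:
  fixes L :: "nat \<Rightarrow> real" and k c :: real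
  assumes k: "0 < k" and L: "\<And>N. N\<^sub>0 \<le> N \<Longrightarrow> real N < L N \<and> L N < real N + 1"
    and lattice: "\<And>N. N\<^sub>0 \<le> N \<Longrightarrow> k * ln (L N) \<in> range (\<lambda>j::int. c * of_int j)"
  shows False
proof -
  have c: "c \<noteq> 0"
  proof
    assume "c = 0"
    then have "k * ln (L (Suc N\<^sub>0)) = 0" using lattice[of "Suc N\<^sub>0"] by auto
    moreover have "1 < L (Suc N\<^sub>0)" using L[of "Suc N\<^sub>0"] by simp
    ultimately show False using k ln_gt_zero[of "L (Suc N\<^sub>0)"] by simp
  qed
  obtain n :: nat where n: "2 * k / \<bar>c\<bar> < n" using reals_Archimedean2 by blast
  \<comment> \<open>The choice of \<open>n\<close> makes \<open>2 k / N\<close> smaller than \<open>\<bar>c\<bar>\<close>.\<close>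
  define N where "N = Suc (max N\<^sub>0 n)"
  have N: "N\<^sub>0 \<le> N" "N\<^sub>0 \<le> Suc N" "2 * k / \<bar>c\<bar> < N" "0 < N" using n by (auto simp: N_def)
  have L0: "real N < L N" "L N < real N + 1" and L1: "real N + 1 < L (Suc N)" "L (Suc N) < real N + 2"
    using L[OF N(1)] L[OF N(2)] by auto
  define d where "d = k * ln (L (Suc N)) - k * ln (L N)"
  obtain i j :: int where ij: "k * ln (L (Suc N)) = c * of_int i" "k * ln (L N) = c * of_int j"
    using lattice N by (metis (no_types, lifting) imageE)
  have "ln (L N) < ln (L (Suc N))" using L0 L1 N by (subst ln_less_cancel_iff) auto
  then have d0: "0 < d" using k by (simp add: d_def)
  have d: "d = c * of_int (i - j)" by (simp add: d_def ij algebra_simps)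
  then have "i - j \<noteq> 0" using d0 by auto
  then have "1 \<le> \<bar>real_of_int (i - j)\<bar>" by linarith
  then have "\<bar>c\<bar> * 1 \<le> \<bar>c\<bar> * \<bar>real_of_int (i - j)\<bar>" by (intro mult_left_mono) auto
  then have "\<bar>c\<bar> \<le> d" using d d0 by (simp add: abs_mult[symmetric])
  moreover have "ln (L (Suc N)) - ln (L N) = ln (L (Suc N) / L N)"
    using L0 L1 N by (subst ln_div) auto
  then have "d = k * ln (L (Suc N) / L N)" by (simp add: d_def flip: right_diff_distrib)
  moreover have "ln (L (Suc N) / L N) \<le> L (Suc N) / L N - 1"
    using L0 L1 N by (intro ln_le_minus_one divide_pos_pos) auto
  moreover have "L (Suc N) / L N \<le> (real N + 2) / real N"
    using L0 L1 N by (intro frac_le) auto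
  moreover have "(real N + 2) / real N - 1 = 2 / N" using N by (simp add: field_simps)
  ultimately have "\<bar>c\<bar> \<le> k * (2 / N)"
    using k by (smt (verit) mult_left_mono)
  moreover have "2 * k < N * \<bar>c\<bar>" using N c by (simp add: pos_divide_less_eq)
  then have "k * (2 / N) < \<bar>c\<bar>" using N by (simp add: pos_divide_less_eq mult.commute)
  ultimately show False by simp
qed

context jacobi_perron begin

text \<open>
  For \<open>N > m\<close> all numerators are positive and smaller than the denominator even on the boundary
  of the cube, so Brouwer's theorem yields a fixed point in the open cube.
\<close>

lemma ramp_fixed_point:
  assumes N: "CARD('m) < N"
  obtains x where "x \<in> open_cube" "branch (ramp N) x = x"
proof -
  have maps: "branch (ramp N) y \<in> open_cube" if y: "y \<in> unit_cube" for y
  proof -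
    have y01: "0 \<le> y $ i" "y $ i \<le> 1" for i using y by (auto simp: unit_cube_def)
    have d: "real N \<le> denom (ramp N) y" using y01 by (simp add: denom_def ramp_def)
    have "0 < numer (ramp N) y i \<and> numer (ramp N) y i < denom (ramp N) y" for i
    proof (cases "i = lst")
      case True
      then show ?thesis using d N card_ge_2 by (simp add: numer_def)
    next
      case False
      then have "pos i < CARD('m)" using pos_le_card[of i] pos_inject[of i lst] by (auto simp: le_less)
      then have "real (pos i) + 1 \<le> CARD('m)" by simp
      then show ?thesis using False d N y01[of i] pos_ge_1[of i] by (simp add: numer_def ramp_def)
    qed
    then have "0 < branch (ramp N) y $ nxt i \<and> branch (ramp N) y $ nxt i < 1" for i
      using d N by (smt (verit) branch_nxt divide_less_eq_1_pos divide_pos_pos)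
    then have "\<forall>j. 0 < branch (ramp N) y $ j \<and> branch (ramp N) y $ j < 1" by (metis nxt_prv)
    then show ?thesis by simp
  qed
  obtain x where x: "x \<in> unit_cube" "branch (ramp N) x = x"
  proof (rule brouwer[of "unit_cube :: (real ^ 'm) set" "branch (ramp N)"])
    show "continuous_on unit_cube (branch (ramp N))"
      using N by (intro continuous_on_subset[OF continuous_on_branch] ramp_digits) (auto simp: unit_cube_def)
    show "branch (ramp N) \<in> unit_cube \<rightarrow> unit_cube" using maps open_cube_subset by blast
    show "(unit_cube :: (real ^ 'm) set) \<noteq> {}" by (auto simp: unit_cube_def intro!: exI[of _ 0])
  qed (auto simp: unit_cube_eq_cbox compact_cbox)
  have "x \<in> open_cube" using maps[OF x(1)] unfolding x(2) .
  then show thesis using x(2) by (rule that)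
qed

lemma ramp_periodic_data:
  assumes N: "CARD('m) < N"
  shows "\<exists>t S x. real N < t \<and> t < real N + 1 \<and> [S] \<in> admissible_words T cells 1 \<and>
    x \<in> unit_cube \<inter> branch_dom T [S] \<and> inverse_branch T [S] x = x \<and>
    - ln (abs_jacobian (inverse_branch T [S]) x) = real (CARD('m) + 1) * ln t"
proof -
  obtain x where x: "x \<in> open_cube" "branch (ramp N) x = x" using ramp_fixed_point[OF N] .
  have d: "admissible_digits (ramp N)" using N by (intro ramp_digits) auto
  have lt: "pos i < pos j \<Longrightarrow> x $ i < x $ j" for i j
    using ramp_branch(2)[of N x i j] N x by simp
  have "inj (\<lambda>i. x $ i)"
  proof (rule injI)
    fix i j assume "x $ i = x $ j"
    then have "\<not> pos i < pos j" "\<not> pos j < pos i" using lt[of i j] lt[of j i] by auto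
    then show "i = j" using pos_inject[of i j] by linarith
  qed
  then obtain q where q: "x \<in> order_chamber q" using in_own_chamber x by blast
  have xd: "x \<in> digit_domain (ramp N)" "T x = x" using branch_in_digit_domain[OF d x(1)] x by auto
  define S where "S = digit_domain (ramp N) \<inter> order_chamber q"
  have S: "S \<in> cells" "x \<in> S" using cellI[OF xd(1) q] xd q by (auto simp: S_def)
  have cell_digits: "cell_digits S = ramp N" using digits_unique[OF cell_props(3)[OF S] xd(1)] .
  have adm: "[S] \<in> admissible_words T cells 1" using S by (auto simp: admissible_words_def)
  have "T x \<in> T ` cylinder T [S]" using S by (intro imageI) auto
  then have bd: "x \<in> branch_dom T [S]" using xd by (simp add: branch_dom_def)
  have inv: "inverse_branch T [S] x = x" using the_inv_into_f_f[OF inj_on_cell[OF S(1)] S(2)] xd by simp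
  define t where "t = x $ lst + real N"
  have l: "real N < t" "t < real N + 1" using x by (auto simp: t_def)
  have "abs_jacobian (inverse_branch T [S]) x = 1 / word_denom (map cell_digits [S]) x ^ (CARD('m) + 1)"
    by (rule abs_jacobian_inverse_branch) (use S bd in auto)
  also have "word_denom (map cell_digits [S]) x = t" by (simp add: cell_digits denom_def ramp_def t_def)
  finally have "- ln (abs_jacobian (inverse_branch T [S]) x) = real (CARD('m) + 1) * ln t"
    using l by (simp only: ln_div ln_one ln_realpow)  (simp add: ln_div ln_realpow del: power_Suc)
  then show ?thesis using l adm bd inv x open_cube_subset by blast
qed

lemma non_arithmeticity_jp: "non_arithmeticity_assumption unit_cube T cells"
  unfolding non_arithmeticity_assumption_def
proof
  assume "\<exists>c::real. {- ln (abs_jacobian (inverse_branch T w) x) | x w n.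
             1 \<le> n \<and> w \<in> admissible_words T cells n \<and>
             x \<in> unit_cube \<inter> branch_dom T w \<and> inverse_branch T w x = x}
          \<subseteq> range (\<lambda>k::int. c * of_int k)"
  then obtain c :: real where c: "{- ln (abs_jacobian (inverse_branch T w) x) | x w n.
             1 \<le> n \<and> w \<in> admissible_words T cells n \<and>
             x \<in> unit_cube \<inter> branch_dom T w \<and> inverse_branch T w x = x}
          \<subseteq> range (\<lambda>k::int. c * of_int k)" by blast
  have "\<exists>t. real N < t \<and> t < real N + 1 \<and> real (CARD('m) + 1) * ln t \<in> range (\<lambda>k::int. c * of_int k)"
    if "CARD('m) + 1 \<le> N" for N
  proof -
    have "CARD('m) < N" using that by simp
    from ramp_periodic_data[OF this] obtain t S x where *: "real N < t" "t < real N + 1" 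
      "[S] \<in> admissible_words T cells 1" "x \<in> unit_cube \<inter> branch_dom T [S]" "inverse_branch T [S] x = x"
      "- ln (abs_jacobian (inverse_branch T [S]) x) = real (CARD('m) + 1) * ln t" by blast
    then have "- ln (abs_jacobian (inverse_branch T [S]) x) \<in> range (\<lambda>k::int. c * of_int k)"
      by (intro subsetD[OF c] CollectI exI[of _ x] exI[of _ "[S]"] exI[of _ 1] conjI refl order_refl)
    then have "real (CARD('m) + 1) * ln t \<in> range (\<lambda>k::int. c * of_int k)" unfolding *(6) .
    then show ?thesis using *(1,2) by (intro exI[of _ t] conjI)
  qed
  then obtain L where L: "\<And>N. CARD('m) + 1 \<le> N \<Longrightarrow> real N < L N \<and> L N < real N + 1 \<and> 
    real (CARD('m) + 1) * ln (L N) \<in> range (\<lambda>k::int. c * of_int k)" by metis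
  show False
    by (rule log_spacing_not_lattice[of "real (CARD('m) + 1)" "CARD('m) + 1" L c]) (use L in auto)
qed

end

section \<open>The Jacobi--Perron algorithm as a Markov system\<close>

theorem proposition2p3:
  fixes e :: "nat \<Rightarrow> 'm::finite"
  assumes "CARD('m) \<ge> 2"
    and "bij_betw e {1..CARD('m)} UNIV"
  shows "piecewise_system unit_cube (jp_map e) (jp_partition e) \<and>
         markov_assumption unit_cube (jp_map e) (jp_partition e) \<and>
         non_arithmeticity_assumption unit_cube (jp_map e) (jp_partition e)"
proof -
  interpret jacobi_perron e using assms by unfold_locales
  show ?thesis
    unfolding markov_assumption_def
    by (intro conjI piecewise_system_jp topologically_transitive_jp uniformly_contracting_jp
        bounded_distortion_jp exI[of _ chambers] markov_partition non_arithmeticity_jp)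
qed

end
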